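(* Let $Y$ be a linear subspace of $\mathbb C^2$, let $K$ be a complex $2\times 2$-matrix, and let $A_{Y,K}$ be the operator on $H_Y$ associated with the form $a_K$ with form domain $V_Y$ (see context). (1) If $Y\neq\{0\}^2$ and $Y\neq\{0\}\times\mathbb C$, then $D(A_{Y,K})$ is the set of all $f\in H^1(0,1)$ such that $\begin{pmatrix}\mu_0(f)\\ \mu_1(f)\end{pmatrix}\in Y$ and such that there exists a unique $c(f)\in\mathbb C$ with $$K\begin{pmatrix}\mu_0(f)\\ \mu_1(f)\end{pmatrix}+\begin{pmatrix}c(f)+f(1)\\ f(0)-f(1)\end{pmatrix}\in Y^\perp ,$$ and for such $f$ $$A_{Y,K}f=-\mathrm{Id}_m^{-1}(f'')-c(f)\,\delta_1 .$$ (2) If $Y=\{0\}^2$ or $Y=\{0\}\times\mathbb C$, the same statement holds with $c(f)=0$; that is, $D(A_{Y,K})$ is the set of all $f\in H^1(0,1)$ such that $\begin{pmatrix}\mu_0(f)\\ \mu_1(f)\end{pmatrix}\in Y$ and $K\begin{pmatrix}\mu_0(f)\\ \mu_1(f)\end{pmatrix}+\begin{pmatrix}f(1)\\ f(0)-f(1)\end{pmatrix}\in Y^\perp$, and $A_{Y,K}f=-\mathrm{Id}_m^{-1}(f'')$.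
   Context: All spaces are complex; inner products are linear in the first argument. $H^1(T):=\{u\in H^1(0,1):u(0)=u(1)\}$, $H^{-1}(T)$ is its dual, with $f\in L^2(0,1)$ identified with $\varphi\mapsto\int_0^1 f\varphi\,dx$; $\delta_1\in H^{-1}(T)$ is evaluation at $1$. Put $\mu_0(\varphi):=\langle\varphi,1\rangle$ for $\varphi\in H^{-1}(T)$ and $\mu_1(f):=\int_0^1(1-x)f(x)\,dx$ for $f\in L^2(0,1)$; $\Gamma_1 f:=(\mu_0(f),\mu_1(f))^\top$. The operator $P:H^{-1}(T)\to L^2(0,1)$ (bounded) is defined by $\langle Pu,\varphi\rangle=\langle u,J\varphi\rangle$, $J\varphi(x):=\int_x^1\big(\varphi(y)-\int_0^1\varphi(z)dz\big)dy$. $H^{-1}(T)$ is equipped with the (equivalent) inner product $(f|g)_{H^{-1}(T)}:=(Pf|Pg)_{L^2}+\mu_0(f)\overline{\mu_0(g)}$. $H:=\{w\in H^{-1}(T):\mu_0(w)=0\}$ with the restricted inner product. $\mathrm{Id}_m:H\to H^{-1}(0,1)=(H^1_0(0,1))'$ is the isomorphism restricting a functional to $H^1_0(0,1)$; explicitly $\langle \mathrm{Id}_m^{-1}\psi,v\rangle=\langle\psi,v-v(1)\rangle$ for $\psi\in H^{-1}(0,1)$, $v\in H^1(T)$. For $f\in H^1(0,1)$, $f''\in H^{-1}(0,1)$ is the distributional second derivative. For a subspace $Y$ of $\mathbb C^2$: $V_Y:=\{f\in L^2(0,1):\Gamma_1 f\in Y\}$ with the $L^2$ inner product; $H_Y:=H$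 if $Y=\{0\}^2$ or $Y=\{0\}\times\mathbb C$, and $H_Y:=H^{-1}(T)$ otherwise ($V_Y$ is dense in $H_Y$). For a complex $2\times2$-matrix $K$, $a_K(f,g):=(f|g)_{L^2}+(K\Gamma_1 f|\Gamma_1 g)_{\mathbb C^2}$, $f,g\in V_Y$. The associated operator is: $D(A_{Y,K}):=\{f\in V_Y:\exists g\in H_Y,\ a_K(f,h)=(g|h)_{H^{-1}(T)}\ \forall h\in V_Y\}$, $A_{Y,K}f:=g$. $Y^\perp$ is the orthogonal complement in $\mathbb C^2$. *)

theory Defs
  imports "HOL-Analysis.Analysis"
begin

text \<open>
  Elements of $L^2(0,1)$ are represented by functions on the reals of which only the
  almost-everywhere class on the open unit interval matters. All sets of functions below are
  closed under almost-everywhere equality on that interval, so equality of such sets is equality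
  of the corresponding sets of classes.
\<close>

section \<open>The spaces $L^2(0,1)$ and $H^1(0,1)$\<close>

abbreviation leb01 :: "real measure" where
  "leb01 \<equiv> lebesgue_on {0<..<1}"

definition L2 :: "(real \<Rightarrow> complex) set" where
  "L2 = {f. f \<in> borel_measurable leb01 \<and> integrable leb01 (\<lambda>x. (cmod (f x))\<^sup>2)}"

definition L2_inner :: "(real \<Rightarrow> complex) \<Rightarrow> (real \<Rightarrow> complex) \<Rightarrow> complex" where
  "L2_inner f g = (LINT x|leb01. f x * cnj (g x))"

definition L2_norm :: "(real \<Rightarrow> complex) \<Rightarrow> real" where
  "L2_norm f = sqrt (LINT x|leb01. (cmod (f x))\<^sup>2)"

text \<open>Weak derivatives, tested against compactly supported $C^1$ functions on the open interval.\<close>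

definition is_weak_deriv :: "(real \<Rightarrow> complex) \<Rightarrow> (real \<Rightarrow> complex) \<Rightarrow> bool" where
  "is_weak_deriv f g \<longleftrightarrow>
     (\<forall>\<phi> \<phi>' a b. 0 < a \<and> b < 1 \<and> (\<forall>x. x \<notin> {a..b} \<longrightarrow> \<phi> x = 0) \<and>
        (\<forall>x. (\<phi> has_vector_derivative \<phi>' x) (at x)) \<and> continuous_on UNIV \<phi>' \<longrightarrow>
        (LINT x|leb01. f x * \<phi>' x) = - (LINT x|leb01. g x * \<phi> x))"

definition H1 :: "(real \<Rightarrow> complex) set" where
  "H1 = {f \<in> L2. \<exists>g\<in>L2. is_weak_deriv f g}"

text \<open>The weak derivative is unique only almost everywhere; any choice will do.\<close>

definition weak_deriv :: "(real \<Rightarrow> complex) \<Rightarrow> real \<Rightarrow> complex" where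
  "weak_deriv f = (SOME g. g \<in> L2 \<and> is_weak_deriv f g)"

definition H1_norm :: "(real \<Rightarrow> complex) \<Rightarrow> real" where
  "H1_norm f = sqrt ((L2_norm f)\<^sup>2 + (L2_norm (weak_deriv f))\<^sup>2)"

text \<open>
  The continuous representative on the closed interval, extended by 0. Point values such as
  $f(0)$ and $f(1)$ of $f \in H^1(0,1)$ are values of this representative.
\<close>

definition crep :: "(real \<Rightarrow> complex) \<Rightarrow> real \<Rightarrow> complex" where
  "crep f = (THE u. continuous_on {0..1} u \<and> (AE x in leb01. u x = f x) \<and>
                    (\<forall>x. x \<notin> {0..1} \<longrightarrow> u x = 0))"

definition H1T :: "(real \<Rightarrow> complex) set" where
  "H1T = {u \<in> H1. crep u 0 = crep u 1}"

definition H10 :: "(real \<Rightarrow> complex) set" where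
  "H10 = {u \<in> H1. crep u 0 = 0 \<and> crep u 1 = 0}"

section \<open>Dual spaces\<close>

text \<open>
  Bounded linear (not antilinear) functionals on a subspace \<open>S\<close> of $H^1(0,1)$, extended by 0
  outside \<open>S\<close> so that equality of functionals is equality of HOL functions. By boundedness such a
  functional depends only on the almost-everywhere class of its argument. Thus \<open>dual_on H10\<close> is
  $H^{-1}(0,1)$ and \<open>dual_on H1T\<close> is $H^{-1}(T)$.
\<close>

definition dual_on :: "(real \<Rightarrow> complex) set \<Rightarrow> ((real \<Rightarrow> complex) \<Rightarrow> complex) set" where
  "dual_on S = {w.
     (\<forall>u\<in>S. \<forall>v\<in>S. w (\<lambda>x. u x + v x) = w u + w v) \<and>
     (\<forall>c. \<forall>u\<in>S. w (\<lambda>x. c * u x) = c * w u) \<and>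
     (\<exists>C. \<forall>u\<in>S. cmod (w u) \<le> C * H1_norm u) \<and>
     (\<forall>u. u \<notin> S \<longrightarrow> w u = 0)}"

abbreviation Hm1T :: "((real \<Rightarrow> complex) \<Rightarrow> complex) set" where
  "Hm1T \<equiv> dual_on H1T"

text \<open>The identification of $f \in L^2(0,1)$ with an element of $H^{-1}(T)$.\<close>

definition emb :: "(real \<Rightarrow> complex) \<Rightarrow> (real \<Rightarrow> complex) \<Rightarrow> complex" where
  "emb f = (\<lambda>\<phi>. if \<phi> \<in> H1T then (LINT x|leb01. f x * \<phi> x) else 0)"

definition delta1 :: "(real \<Rightarrow> complex) \<Rightarrow> complex" where
  "delta1 = (\<lambda>\<phi>. if \<phi> \<in> H1T then crep \<phi> 1 else 0)"

definition mu0 :: "((real \<Rightarrow> complex) \<Rightarrow> complex) \<Rightarrow> complex" where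
  "mu0 w = w (\<lambda>_. 1)"

definition mu1 :: "(real \<Rightarrow> complex) \<Rightarrow> complex" where
  "mu1 f = (LINT x|leb01. of_real (1 - x) * f x)"

definition Gamma1 :: "(real \<Rightarrow> complex) \<Rightarrow> complex^2" where
  "Gamma1 f = vector [mu0 (emb f), mu1 f]"

definition J_op :: "(real \<Rightarrow> complex) \<Rightarrow> real \<Rightarrow> complex" where
  "J_op \<phi> x = (LINT y|lebesgue_on {x<..<1}. \<phi> y - (LINT z|leb01. \<phi> z))"

definition P_op :: "((real \<Rightarrow> complex) \<Rightarrow> complex) \<Rightarrow> real \<Rightarrow> complex" where
  "P_op u = (SOME p. p \<in> L2 \<and> (\<forall>\<phi>\<in>L2. (LINT x|leb01. p x * \<phi> x) = u (J_op \<phi>)))"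

definition Hm1T_inner ::
  "((real \<Rightarrow> complex) \<Rightarrow> complex) \<Rightarrow> ((real \<Rightarrow> complex) \<Rightarrow> complex) \<Rightarrow> complex" where
  "Hm1T_inner f g = L2_inner (P_op f) (P_op g) + mu0 f * cnj (mu0 g)"

definition Hzero :: "((real \<Rightarrow> complex) \<Rightarrow> complex) set" where
  "Hzero = {w \<in> Hm1T. mu0 w = 0}"

definition Id_m :: "((real \<Rightarrow> complex) \<Rightarrow> complex) \<Rightarrow> (real \<Rightarrow> complex) \<Rightarrow> complex" where
  "Id_m w = (\<lambda>v. if v \<in> H10 then w v else 0)"

definition Id_m_inv :: "((real \<Rightarrow> complex) \<Rightarrow> complex) \<Rightarrow> (real \<Rightarrow> complex) \<Rightarrow> complex" where
  "Id_m_inv = the_inv_into Hzero Id_m"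

text \<open>The distributional second derivative of $f \in H^1(0,1)$, as an element of $H^{-1}(0,1)$.\<close>

definition second_deriv :: "(real \<Rightarrow> complex) \<Rightarrow> (real \<Rightarrow> complex) \<Rightarrow> complex" where
  "second_deriv f =
     (\<lambda>v. if v \<in> H10 then - (LINT x|leb01. weak_deriv f x * weak_deriv v x) else 0)"

section \<open>The form and the associated operator\<close>

definition C2_inner :: "complex^2 \<Rightarrow> complex^2 \<Rightarrow> complex" where
  "C2_inner x y = (\<Sum>i\<in>UNIV. x $ i * cnj (y $ i))"

definition C2_perp :: "(complex^2) set \<Rightarrow> (complex^2) set" where
  "C2_perp Y = {z. \<forall>y\<in>Y. C2_inner z y = 0}"

text \<open>The subspace $\{0\} \times \mathbb{C}$ of $\mathbb{C}^2$.\<close>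

definition zero_times_C :: "(complex^2) set" where
  "zero_times_C = {y. y $ 1 = 0}"

definition V_Y :: "(complex^2) set \<Rightarrow> (real \<Rightarrow> complex) set" where
  "V_Y Y = {f \<in> L2. Gamma1 f \<in> Y}"

definition H_Y :: "(complex^2) set \<Rightarrow> ((real \<Rightarrow> complex) \<Rightarrow> complex) set" where
  "H_Y Y = (if Y = {0} \<or> Y = zero_times_C then Hzero else Hm1T)"

definition a_form :: "complex^2^2 \<Rightarrow> (real \<Rightarrow> complex) \<Rightarrow> (real \<Rightarrow> complex) \<Rightarrow> complex" where
  "a_form K f g = L2_inner f g + C2_inner (K *v Gamma1 f) (Gamma1 g)"

definition A_dom :: "(complex^2) set \<Rightarrow> complex^2^2 \<Rightarrow> (real \<Rightarrow> complex) set" where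
  "A_dom Y K = {f \<in> V_Y Y. \<exists>g\<in>H_Y Y. \<forall>h\<in>V_Y Y. a_form K f h = Hm1T_inner g (emb h)}"

definition A_op ::
  "(complex^2) set \<Rightarrow> complex^2^2 \<Rightarrow> (real \<Rightarrow> complex) \<Rightarrow> (real \<Rightarrow> complex) \<Rightarrow> complex" where
  "A_op Y K f = (THE g. g \<in> H_Y Y \<and> (\<forall>h\<in>V_Y Y. a_form K f h = Hm1T_inner g (emb h)))"

end

theory Submission
  imports Defs
begin

text \<open>
  With $F(x) = \int_0^x h$ one has $P h = F - \mu_1(h)$ for $h \in L^2(0,1)$, and $Pg$ has mean zero,
  so Fubini gives $(g|h)_{H^{-1}(T)} = -(\int_0^\cdot Pg\,|\,h)_{L^2} + \mu_0(g)\overline{\mu_0(h)}$.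
  Hence $a_K(f,h) = (g|h)$ for all $h \in V_Y$ says that
  $(f + \int_0^\cdot Pg\,|\,h)_{L^2} + (K\Gamma_1 f - (\mu_0(g),0)^\top\,|\,\Gamma_1 h)_{\mathbb{C}^2}$ vanishes
  on $V_Y$. Testing with $\Gamma_1 h = 0$ gives
  $f = a + b(1-x) - \int_0^x Pg$, so $f \in H^1(0,1)$ with $f(1) = a$, $f(0) = a + b$ and
  $Pg = \int_0^1 f' - f'$; the remaining condition is
  $K\Gamma_1 f + (a - \mu_0(g), b)^\top \in Y^\perp$ since $\Gamma_1$ is onto $\mathbb{C}^2$. A
  functional is determined by $Pg$ and $\mu_0(g)$, so this identifies $g$ as
  $-\mathrm{Id}_m^{-1}(f'') + \mu_0(g)\,\delta_1$, that is, $c(f) = -\mu_0(g)$.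
  The existence of $Pg \in L^2(0,1)$ for an arbitrary functional $g$ is the Riesz representation
  theorem, and the primitive representation of $H^1(0,1)$ is the lemma of du Bois-Reymond.
\<close>

section \<open>The Hilbert space $L^2(0,1)$\<close>

text \<open>The entries of \<open>Gamma1 h\<close> are the integrals of h against 1 and 1 - x, so
  the orthogonal complement of the kernel of \<open>Gamma1\<close> consists of the affine functions.
  It is reached by hand: an affine function with the same moments is subtracted and the remainder is
  tested against itself. The affine part carries the boundary values, because the primitive of Pg
  vanishes at both ends of the interval. The number c records how g acts on constants, which Pg
  cannot see. If Y has a vector with nonzero first entry, membership in Y^perp fixes c; otherwise
  Y^perp contains C x {0} and leaves c free, and the mean-zero space \<open>Hzero\<close> forces c =
  0. The same uniqueness makes the definite description in \<open>A_op\<close> meaningful. Functions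
  stand for their classes and \<open>P_op\<close>, \<open>weak_deriv\<close> are choices, so
  identities for them hold almost everywhere, and functionals must be shown insensitive to null sets
  before linearity of J can be used.\<close>

lemma emeasure_leb01: "emeasure leb01 {0<..<1} = 1"
  by (subst emeasure_restrict_space) auto

interpretation leb01: finite_measure leb01
  by standard (simp add: emeasure_leb01)

lemma measure_leb01 [simp]: "measure leb01 {0<..<1} = 1"
  by (simp add: measure_def emeasure_leb01)

lemma integral_leb01_const: "(LINT x|leb01. (c::'a::euclidean_space)) = c"
  by simp

section \<open>Membership in L^2 and its closure properties\<close>

lemma L2_measurable: "f \<in> L2 \<Longrightarrow> f \<in> borel_measurable leb01"
  and L2_square_integrable: "f \<in> L2 \<Longrightarrow> integrable leb01 (\<lambda>x. (cmod (f x))\<^sup>2)"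
  by (auto simp: L2_def)

lemma L2I_bound:
  assumes "f \<in> borel_measurable leb01" "integrable leb01 g"
    and "AE x in leb01. (cmod (f x))\<^sup>2 \<le> g x"
  shows "f \<in> L2"
  unfolding L2_def
proof (intro CollectI conjI assms)
  have [measurable]: "f \<in> borel_measurable leb01" by fact
  show "integrable leb01 (\<lambda>x. (cmod (f x))\<^sup>2)"
  proof (rule Bochner_Integration.integrable_bound[OF assms(2)])
    show "AE x in leb01. norm ((cmod (f x))\<^sup>2) \<le> norm (g x)"
      using assms(3) by eventually_elim auto
  qed simp
qed

lemma L2_bounded:
  assumes "f \<in> borel_measurable leb01" "\<And>x. 0 < x \<Longrightarrow> x < 1 \<Longrightarrow> cmod (f x) \<le> B"
  shows "f \<in> L2"
proof (rule L2I_bound[OF assms(1)])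
  show "integrable leb01 (\<lambda>x. B\<^sup>2)" by simp
  show "AE x in leb01. (cmod (f x))\<^sup>2 \<le> B\<^sup>2"
    by (rule AE_I2) (auto intro!: power_mono assms)
qed

lemma measurable_leb01_continuous:
  fixes f :: "real \<Rightarrow> complex"
  assumes "continuous_on {0..1} f"
  shows "f \<in> borel_measurable leb01"
  by (rule continuous_imp_measurable_on_sets_lebesgue)
    (auto intro: continuous_on_subset[OF assms])

lemma L2_continuous:
  assumes "continuous_on {0..1} f"
  shows "f \<in> L2"
proof -
  have "bounded (f ` {0..1})"
    by (intro compact_imp_bounded compact_continuous_image assms) auto
  then obtain B where "\<forall>x\<in>{0..1}. cmod (f x) \<le> B"
    unfolding bounded_iff by auto
  then show ?thesis
    by (intro L2_bounded[of _ B] measurable_leb01_continuous assms) auto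
qed

lemma L2_const: "(\<lambda>x. c) \<in> L2"
  by (intro L2_continuous continuous_intros)

lemma L2_cong_AE:
  assumes "f \<in> L2" "g \<in> borel_measurable leb01" "AE x in leb01. g x = f x"
  shows "g \<in> L2"
  by (rule L2I_bound[OF assms(2) L2_square_integrable[OF assms(1)]])
    (use assms(3) in eventually_elim, simp)

lemma L2_add:
  assumes "f \<in> L2" "g \<in> L2"
  shows "(\<lambda>x. f x + g x) \<in> L2"
proof (rule L2I_bound)
  show "(\<lambda>x. f x + g x) \<in> borel_measurable leb01"
    by (intro borel_measurable_add borel_measurable_times L2_measurable assms)
  show "integrable leb01 (\<lambda>x. 2 * (cmod (f x))\<^sup>2 + 2 * (cmod (g x))\<^sup>2)"
    by (intro Bochner_Integration.integrable_add integrable_mult_right L2_square_integrable assms)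
  have "(cmod (f x + g x))\<^sup>2 \<le> 2 * (cmod (f x))\<^sup>2 + 2 * (cmod (g x))\<^sup>2" for x
  proof -
    have "(cmod (f x + g x))\<^sup>2 \<le> (cmod (f x) + cmod (g x))\<^sup>2"
      by (intro power_mono norm_triangle_ineq) auto
    also have "\<dots> \<le> 2 * (cmod (f x))\<^sup>2 + 2 * (cmod (g x))\<^sup>2"
      using sum_squares_bound[of "cmod (f x)" "cmod (g x)"] by (simp add: power2_sum)
    finally show ?thesis .
  qed
  then show "AE x in leb01. (cmod (f x + g x))\<^sup>2 \<le> 2 * (cmod (f x))\<^sup>2 + 2 * (cmod (g x))\<^sup>2"
    by simp
qed

lemma L2_cmult: "f \<in> L2 \<Longrightarrow> (\<lambda>x. c * f x) \<in> L2"
  by (auto simp: L2_def norm_mult power_mult_distrib)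

lemma L2_cnj: "f \<in> L2 \<Longrightarrow> (\<lambda>x. cnj (f x)) \<in> L2"
  using borel_measurable_continuous_on[OF linear_continuous_on[OF bounded_linear_cnj], of f leb01]
  by (simp add: L2_def)

lemma L2_minus: "f \<in> L2 \<Longrightarrow> (\<lambda>x. - f x) \<in> L2"
  using L2_cmult[of f "-1"] by simp

lemma L2_diff: "f \<in> L2 \<Longrightarrow> g \<in> L2 \<Longrightarrow> (\<lambda>x. f x - g x) \<in> L2"
  using L2_add[of f "\<lambda>x. - g x"] L2_minus by simp

lemmas L2_intros = L2_add L2_cmult L2_cnj L2_minus L2_diff L2_const

lemma L2_mult_integrable:
  assumes "f \<in> L2" "g \<in> L2"
  shows "integrable leb01 (\<lambda>x. f x * g x)"
proof (rule Bochner_Integration.integrable_bound)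
  show "integrable leb01 (\<lambda>x. (cmod (f x))\<^sup>2 + (cmod (g x))\<^sup>2)"
    by (intro Bochner_Integration.integrable_add integrable_mult_right L2_square_integrable assms)
  show "(\<lambda>x. f x * g x) \<in> borel_measurable leb01"
    by (intro borel_measurable_add borel_measurable_times L2_measurable assms)
  have "cmod (f x * g x) \<le> (cmod (f x))\<^sup>2 + (cmod (g x))\<^sup>2" for x
  proof -
    have "0 \<le> cmod (f x) * cmod (g x)" by simp
    with sum_squares_bound[of "cmod (f x)" "cmod (g x)"] show ?thesis
      unfolding norm_mult by linarith
  qed
  then show "AE x in leb01. norm (f x * g x) \<le> norm ((cmod (f x))\<^sup>2 + (cmod (g x))\<^sup>2)"
    by auto
qed

lemma L2_integrable: "f \<in> L2 \<Longrightarrow> integrable leb01 f"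
  using L2_mult_integrable[OF _ L2_const[of 1]] by simp

section \<open>The norm, the Cauchy-Schwarz inequality and separation by test functions\<close>

lemma L2_norm_nonneg: "L2_norm f \<ge> 0"
  by (auto simp: L2_norm_def)

lemma L2_norm_square: "(L2_norm f)\<^sup>2 = (LINT x|leb01. (cmod (f x))\<^sup>2)"
  by (auto simp: L2_norm_def)

lemma L2_norm_cong_AE:
  assumes "f \<in> borel_measurable leb01" "g \<in> borel_measurable leb01" "AE x in leb01. f x = g x"
  shows "L2_norm f = L2_norm g"
  unfolding L2_norm_def
  by (intro arg_cong[of _ _ sqrt] integral_cong_AE) (use assms in auto)

text \<open>Taken from the inequality for nonnegative extended integrals; square integrability turns
  all integrals involved into real ones.\<close>

lemma L2_Cauchy_Schwarz_abs:
  assumes "f \<in> L2" "g \<in> L2"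
  shows "(LINT x|leb01. cmod (f x) * cmod (g x)) \<le> L2_norm f * L2_norm g"
proof -
  have [measurable]: "f \<in> borel_measurable leb01" "g \<in> borel_measurable leb01"
    using assms by (auto dest: L2_measurable)
  let ?I = "LINT x|leb01. cmod (f x) * cmod (g x)"
  have int: "integrable leb01 (\<lambda>x. cmod (f x) * cmod (g x))"
    using integrable_norm[OF L2_mult_integrable[OF assms]] by (simp add: norm_mult)
  have "ennreal (?I\<^sup>2) = (ennreal ?I)\<^sup>2"
    by (simp add: ennreal_power)
  also have "ennreal ?I = (\<integral>\<^sup>+x. ennreal (cmod (f x)) * ennreal (cmod (g x)) \<partial>leb01)"
    by (subst nn_integral_eq_integral[symmetric]) (use int in \<open>auto simp: ennreal_mult\<close>)
  also have "\<dots>\<^sup>2 \<le> (\<integral>\<^sup>+x. ennreal (cmod (f x))^2 \<partial>leb01) * (\<integral>\<^sup>+x. ennreal (cmod (g x))^2 \<partial>leb01)"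
    by (rule Cauchy_Schwarz_nn_integral) auto
  also have "(\<integral>\<^sup>+x. ennreal (cmod (f x))^2 \<partial>leb01) = ennreal ((L2_norm f)\<^sup>2)"
    unfolding L2_norm_square
    by (subst nn_integral_eq_integral[symmetric])
      (use assms in \<open>auto simp: ennreal_power L2_square_integrable\<close>)
  also have "(\<integral>\<^sup>+x. ennreal (cmod (g x))^2 \<partial>leb01) = ennreal ((L2_norm g)\<^sup>2)"
    unfolding L2_norm_square
    by (subst nn_integral_eq_integral[symmetric])
      (use assms in \<open>auto simp: ennreal_power L2_square_integrable\<close>)
  finally have "?I\<^sup>2 \<le> (L2_norm f * L2_norm g)\<^sup>2"
    by (simp add: ennreal_mult[symmetric] power_mult_distrib)
  then show ?thesis
    by (rule power2_le_imp_le) (simp add: L2_norm_nonneg)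
qed

lemma L2_Cauchy_Schwarz:
  assumes "f \<in> L2" "g \<in> L2"
  shows "cmod (LINT x|leb01. f x * g x) \<le> L2_norm f * L2_norm g"
  using integral_norm_bound[of leb01 "\<lambda>x. f x * g x"] L2_Cauchy_Schwarz_abs[OF assms]
  by (simp add: norm_mult)

lemma L2_norm_cmult: "L2_norm (\<lambda>x. c * f x) = cmod c * L2_norm f"
  by (simp add: L2_norm_def norm_mult power_mult_distrib real_sqrt_mult)

lemma L2_norm_const: "L2_norm (\<lambda>x. c) = cmod c"
  by (simp only: L2_norm_def integral_leb01_const) simp

lemma integral_norm_le_L2_norm:
  assumes "f \<in> L2"
  shows "(LINT x|leb01. cmod (f x)) \<le> L2_norm f"
  using L2_Cauchy_Schwarz_abs[OF assms L2_const[of 1]] by (simp add: L2_norm_const)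

lemma L2_orthogonal_imp_zero:
  assumes "f \<in> L2" "(LINT x|leb01. f x * cnj (f x)) = 0"
  shows "AE x in leb01. f x = 0"
proof -
  have "complex_of_real (LINT x|leb01. (cmod (f x))\<^sup>2) = (LINT x|leb01. f x * cnj (f x))"
    unfolding integral_complex_of_real[symmetric] complex_norm_square ..
  then have "(LINT x|leb01. (cmod (f x))\<^sup>2) = 0"
    using assms by simp
  then show ?thesis
    using integral_nonneg_eq_0_iff_AE[OF L2_square_integrable[OF assms(1)]] by auto
qed

text \<open>The pairing is bilinear, so the decisive test function is the conjugate of p -
  q.\<close>

lemma L2_eq_AE_if_tested:
  assumes "p \<in> L2" "q \<in> L2" "\<And>\<phi>. \<phi> \<in> L2 \<Longrightarrow> (LINT x|leb01. p x * \<phi> x) = (LINT x|leb01. q x * \<phi> x)"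
  shows "AE x in leb01. p x = q x"
proof -
  let ?d = "\<lambda>x. p x - q x"
  have d: "?d \<in> L2" "(\<lambda>x. cnj (?d x)) \<in> L2" using assms by (auto intro!: L2_intros)
  have "(LINT x|leb01. ?d x * cnj (?d x)) =
      (LINT x|leb01. p x * cnj (?d x)) - (LINT x|leb01. q x * cnj (?d x))"
    unfolding left_diff_distrib
    by (rule Bochner_Integration.integral_diff) (intro L2_mult_integrable assms d)+
  then have "AE x in leb01. ?d x = 0"
    using assms(3)[OF d(2)] by (intro L2_orthogonal_imp_zero d) simp
  then show ?thesis by auto
qed

lemma L2_norm_add_square:
  assumes "f \<in> L2" "g \<in> L2"
  shows "(L2_norm (\<lambda>x. f x + g x))\<^sup>2 =
    (L2_norm f)\<^sup>2 + (L2_norm g)\<^sup>2 + 2 * Re (LINT x|leb01. f x * cnj (g x))"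
proof -
  have int: "integrable leb01 (\<lambda>x. f x * cnj (g x))"
    by (intro L2_mult_integrable L2_intros assms)
  have "(L2_norm (\<lambda>x. f x + g x))\<^sup>2 =
      (LINT x|leb01. ((cmod (f x))\<^sup>2 + (cmod (g x))\<^sup>2) + 2 * Re (f x * cnj (g x)))"
    unfolding L2_norm_square
    by (intro Bochner_Integration.integral_cong refl)
      (simp only: cmod_power2, simp add: power2_eq_square algebra_simps)
  also have "\<dots> = (L2_norm f)\<^sup>2 + (L2_norm g)\<^sup>2 + 2 * (LINT x|leb01. Re (f x * cnj (g x)))"
    unfolding L2_norm_square
    using assms[THEN L2_square_integrable] integrable_Re[OF int]
    by (simp del: times_complex.sel complex_cnj)
  finally show ?thesis by (simp only: integral_Re[OF int])
qed

text \<open>Riesz-Fischer for a sequence with a geometric Cauchy rate. The total mass is 1, so the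
  L^1 norm is at most the L^2 norm and the increments are summable in L^1; this gives almost
  everywhere convergence of the whole sequence. Fatou's lemma carries the L^2 bounds to the
  limit.\<close>

lemma L2_complete_geometric:
  fixes u :: "nat \<Rightarrow> real \<Rightarrow> complex"
  assumes u: "\<And>n. u n \<in> L2"
    and cauchy: "\<And>n m. n \<le> m \<Longrightarrow> L2_norm (\<lambda>x. u m x - u n x) \<le> B * (1/2)^n"
  obtains v where "v \<in> L2" "\<And>n. L2_norm (\<lambda>x. v x - u n x) \<le> B * (1/2)^n"
proof -
  have [measurable]: "u n \<in> borel_measurable leb01" for n by (rule L2_measurable[OF u])
  have B: "B \<ge> 0" using cauchy[of 0 0] L2_norm_nonneg[of "\<lambda>x. u 0 x - u 0 x"] by simp
  let ?d = "\<lambda>n x. u (Suc n) x - u n x"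
  have d: "?d n \<in> L2" for n by (intro L2_intros u)
  have int_d: "(LINT x|leb01. cmod (?d n x)) \<le> B * (1/2)^n" for n
    using integral_norm_le_L2_norm[OF d, of n] cauchy[of n "Suc n"] by linarith
  have "(\<integral>\<^sup>+x. (\<Sum>n. ennreal (cmod (?d n x))) \<partial>leb01) = (\<Sum>n. \<integral>\<^sup>+x. ennreal (cmod (?d n x)) \<partial>leb01)"
    by (rule nn_integral_suminf) measurable
  also have "\<dots> \<le> (\<Sum>n. ennreal (B * (1/2)^n))"
  proof (intro suminf_le summableI)
    fix n
    have "(\<integral>\<^sup>+x. ennreal (cmod (?d n x)) \<partial>leb01) = ennreal (LINT x|leb01. cmod (?d n x))"
      by (rule nn_integral_eq_integral[OF integrable_norm[OF L2_integrable[OF d]]]) simp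
    then show "(\<integral>\<^sup>+x. ennreal (cmod (?d n x)) \<partial>leb01) \<le> ennreal (B * (1/2)^n)"
      using int_d[of n] by (simp add: ennreal_leI)
  qed
  also have "\<dots> < \<infinity>"
  proof -
    have "summable (\<lambda>n. B * (1/2)^n :: real)" by (intro summable_mult summable_geometric) auto
    then show ?thesis using B by (subst suminf_ennreal2) (auto simp: less_top[symmetric])
  qed
  finally have "AE x in leb01. (\<Sum>n. ennreal (cmod (?d n x))) \<noteq> \<infinity>"
    by (intro nn_integral_PInf_AE) auto
  then have conv: "AE x in leb01. convergent (\<lambda>n. u n x)"
  proof eventually_elim
    case (elim x)
    then have "summable (\<lambda>n. cmod (?d n x))"
      by (intro summable_suminf_not_top) auto
    then have "summable (\<lambda>n. ?d n x)" by (rule summable_norm_cancel)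
    then have "convergent (\<lambda>n. \<Sum>k<n. ?d k x)" by (simp add: summable_iff_convergent)
    then have "convergent (\<lambda>n. u n x - u 0 x)" unfolding sum_lessThan_telescope[of "\<lambda>n. u n x"] .
    from convergent_add[OF this convergent_const[of "u 0 x"]] show ?case by simp
  qed
  \<comment> \<open>The arbitrary value of \<open>lim\<close> at points of divergence affects only a
    null set.\<close>
  define v where "v x = lim (\<lambda>n. u n x)" for x
  have [measurable]: "v \<in> borel_measurable leb01"
    unfolding v_def by measurable
  have lim: "AE x in leb01. (\<lambda>n. u n x) \<longlonglongrightarrow> v x"
    using conv by eventually_elim (simp add: v_def convergent_LIMSEQ_iff)
  have le: "(\<integral>\<^sup>+x. ennreal ((cmod (v x - u n x))\<^sup>2) \<partial>leb01) \<le> ennreal ((B * (1/2)^n)\<^sup>2)" for n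
  proof -
    have "(\<integral>\<^sup>+x. ennreal ((cmod (v x - u n x))\<^sup>2) \<partial>leb01) =
        (\<integral>\<^sup>+x. liminf (\<lambda>m. ennreal ((cmod (u m x - u n x))\<^sup>2)) \<partial>leb01)"
    proof (rule nn_integral_cong_AE)
      show "AE x in leb01. ennreal ((cmod (v x - u n x))\<^sup>2) = liminf (\<lambda>m. ennreal ((cmod (u m x - u n x))\<^sup>2))"
        using lim
      proof eventually_elim
        case (elim x)
        then have "(\<lambda>m. ennreal ((cmod (u m x - u n x))\<^sup>2)) \<longlonglongrightarrow> ennreal ((cmod (v x - u n x))\<^sup>2)"
          by (intro tendsto_ennrealI tendsto_intros)
        then show ?case by (rule lim_imp_Liminf[OF sequentially_bot, symmetric])
      qed
    qed
    also have "\<dots> \<le> liminf (\<lambda>m. \<integral>\<^sup>+x. ennreal ((cmod (u m x - u n x))\<^sup>2) \<partial>leb01)"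
      by (rule nn_integral_liminf) measurable
    also have "\<dots> \<le> ennreal ((B * (1/2)^n)\<^sup>2)"
    proof (rule Liminf_le)
      show "\<forall>\<^sub>F m in sequentially. (\<integral>\<^sup>+x. ennreal ((cmod (u m x - u n x))\<^sup>2) \<partial>leb01) \<le> ennreal ((B * (1/2)^n)\<^sup>2)"
      proof (rule eventually_sequentiallyI[of n])
        fix m assume "n \<le> m"
        have "(\<integral>\<^sup>+x. ennreal ((cmod (u m x - u n x))\<^sup>2) \<partial>leb01) = ennreal ((L2_norm (\<lambda>x. u m x - u n x))\<^sup>2)"
          unfolding L2_norm_square
          by (rule nn_integral_eq_integral[OF L2_square_integrable[OF L2_diff[OF u u]]]) simp
        also have "\<dots> \<le> ennreal ((B * (1/2)^n)\<^sup>2)"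
          by (intro ennreal_leI power_mono cauchy \<open>n \<le> m\<close> L2_norm_nonneg)
        finally show "(\<integral>\<^sup>+x. ennreal ((cmod (u m x - u n x))\<^sup>2) \<partial>leb01) \<le> ennreal ((B * (1/2)^n)\<^sup>2)" .
      qed
    qed simp
    finally show ?thesis .
  qed
  have vu: "(\<lambda>x. v x - u n x) \<in> L2" for n
    unfolding L2_def
    using le[of n] by (auto intro!: integrableI_bounded intro: le_less_trans[OF _ ennreal_less_top])
  have "(\<lambda>x. (v x - u 0 x) + u 0 x) \<in> L2" by (rule L2_add[OF vu u])
  then have "v \<in> L2" by simp
  moreover have "L2_norm (\<lambda>x. v x - u n x) \<le> B * (1/2)^n" for n
  proof (rule power2_le_imp_le)
    have "ennreal ((L2_norm (\<lambda>x. v x - u n x))\<^sup>2) = (\<integral>\<^sup>+x. ennreal ((cmod (v x - u n x))\<^sup>2) \<partial>leb01)"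
      unfolding L2_norm_square
      by (rule nn_integral_eq_integral[OF L2_square_integrable[OF vu], symmetric]) simp
    with le[of n] have "ennreal ((L2_norm (\<lambda>x. v x - u n x))\<^sup>2) \<le> ennreal ((B * (1/2)^n)\<^sup>2)"
      by (simp only:)
    then show "(L2_norm (\<lambda>x. v x - u n x))\<^sup>2 \<le> (B * (1/2)^n)\<^sup>2"
      by (rule ennreal_le_iff[THEN iffD1, rotated]) simp
  qed (use B in auto)
  ultimately show ?thesis by (rule that)
qed

text \<open>The representing function is the conjugate of the minimiser of $\|f\|^2 - 2\,\mathrm{Re}\, l(f)$.\<close>

theorem L2_Riesz:
  fixes l :: "(real \<Rightarrow> complex) \<Rightarrow> complex"
  assumes add: "\<And>f g. f \<in> L2 \<Longrightarrow> g \<in> L2 \<Longrightarrow> l (\<lambda>x. f x + g x) = l f + l g"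
    and cmult: "\<And>c f. f \<in> L2 \<Longrightarrow> l (\<lambda>x. c * f x) = c * l f"
    and bound: "\<And>f. f \<in> L2 \<Longrightarrow> cmod (l f) \<le> C * L2_norm f"
  obtains p where "p \<in> L2" "\<And>\<phi>. \<phi> \<in> L2 \<Longrightarrow> (LINT x|leb01. p x * \<phi> x) = l \<phi>"
proof -
  define E where "E f = (L2_norm f)\<^sup>2 - 2 * Re (l f)" for f
  \<comment> \<open>Completing the square: E f is at least |f|^2 - 2 C |f|, hence at least
    -C^2.\<close>
  have E_ge: "E f \<ge> - C\<^sup>2" if "f \<in> L2" for f
  proof -
    have "Re (l f) \<le> C * L2_norm f"
      using bound[OF that] complex_Re_le_cmod[of "l f"] by linarith
    moreover have "0 \<le> (L2_norm f - C)\<^sup>2" by simp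
    ultimately show ?thesis unfolding E_def by (simp add: power2_diff mult.commute)
  qed
  define m where "m = Inf (E ` L2)"
  have bdd: "bdd_below (E ` L2)" using E_ge by (auto intro!: bdd_belowI[of _ "- C\<^sup>2"])
  have ne: "L2 \<noteq> {}" using L2_const by auto
  have m_le: "m \<le> E f" if "f \<in> L2" for f
    unfolding m_def using that by (intro cInf_lower bdd) auto
  have "\<exists>f\<in>L2. E f < m + (1/4)^n" for n :: nat
  proof -
    have "Inf (E ` L2) < m + (1/4)^n" by (simp add: m_def)
    then show ?thesis using cInf_less_iff[of "E ` L2"] ne bdd by auto
  qed
  then obtain u where u: "\<And>n. u n \<in> L2" and Eu: "\<And>n. E (u n) < m + (1/4)^n"
    by metis
  \<comment> \<open>Parallelogram law: |a - b|^2 = 2 E a + 2 E b - 4 E ((a + b)/2), and E is at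
    least m at the midpoint. Near-minimisers are therefore close to each other.\<close>
  have diff_le: "(L2_norm (\<lambda>x. a x - b x))\<^sup>2 \<le> 2 * (E a - m) + 2 * (E b - m)"
    if a: "a \<in> L2" and b: "b \<in> L2" for a b
  proof -
    let ?I = "LINT x|leb01. a x * cnj (b x)"
    have 1: "(L2_norm (\<lambda>x. a x - b x))\<^sup>2 = (L2_norm a)\<^sup>2 + (L2_norm b)\<^sup>2 - 2 * Re ?I"
      using L2_norm_add_square[OF a L2_cmult[OF b, of "-1"]] L2_norm_cmult[of "-1" b] by simp
    have 2: "(L2_norm (\<lambda>x. 1/2 * a x + 1/2 * b x))\<^sup>2
        = (L2_norm a)\<^sup>2 / 4 + (L2_norm b)\<^sup>2 / 4 + Re ?I / 2"
      unfolding L2_norm_add_square[OF L2_cmult[OF a, of "1/2"] L2_cmult[OF b, of "1/2"]]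
        L2_norm_cmult by (simp add: power2_eq_square)
    have 3: "l (\<lambda>x. 1/2 * a x + 1/2 * b x) = l a / 2 + l b / 2"
      unfolding add[OF L2_cmult[OF a, of "1/2"] L2_cmult[OF b, of "1/2"]] cmult[OF a, of "1/2"]
        cmult[OF b, of "1/2"] by simp
    have "m \<le> E (\<lambda>x. 1/2 * a x + 1/2 * b x)"
      by (intro m_le L2_intros a b)
    then show ?thesis unfolding E_def 1 2 3 by simp
  qed
  \<comment> \<open>The tolerance (1/4)^n for E becomes the rate (1/2)^n for the norm.\<close>
  have "L2_norm (\<lambda>x. u k x - u n x) \<le> 2 * (1/2)^n" if "n \<le> k" for n k
  proof (rule power2_le_imp_le)
    have arith: "x \<le> 4 * q" if "p \<le> q" "x \<le> 2 * (a - m) + 2 * (b - m)" "a < m + p" "b < m + q"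
      for x p q a b :: real using that by (smt (verit))
    have "(1/4::real)^k \<le> (1/4)^n" using that by (intro power_decreasing) auto
    then have "(L2_norm (\<lambda>x. u k x - u n x))\<^sup>2 \<le> 4 * (1/4)^n"
      by (rule arith[OF _ diff_le[OF u u, of k n] Eu[of k] Eu[of n]])
    also have "\<dots> = (2 * (1/2)^n)\<^sup>2"
      by (simp add: power_mult_distrib power2_eq_square flip: power_mult_distrib)
    finally show "(L2_norm (\<lambda>x. u k x - u n x))\<^sup>2 \<le> (2 * (1/2)^n)\<^sup>2" .
  qed simp
  from L2_complete_geometric[of u 2, OF u this]
  obtain v where v: "v \<in> L2" and vu: "\<And>n. L2_norm (\<lambda>x. v x - u n x) \<le> 2 * (1/2)^n"
    by blast
  have Re_eq: "Re (LINT x|leb01. v x * cnj (h x)) = Re (l h)" if h: "h \<in> L2" for h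
  proof -
    \<comment> \<open>Half the derivative of E at f in direction h; the aim is e v = 0.\<close>
    define e where "e f = Re (LINT x|leb01. f x * cnj (h x)) - Re (l h)" for f
    have E_add: "E (\<lambda>x. f x + of_real t * h x) = E f + 2 * t * e f + t\<^sup>2 * (L2_norm h)\<^sup>2"
      if f: "f \<in> L2" for f t
    proof -
      have "l (\<lambda>x. f x + of_real t * h x) = l f + of_real t * l h"
        using add[OF f L2_cmult[OF h]] cmult[OF h] by simp
      moreover have "(L2_norm (\<lambda>x. f x + of_real t * h x))\<^sup>2 = (L2_norm f)\<^sup>2 + t\<^sup>2 * (L2_norm h)\<^sup>2
          + 2 * t * Re (LINT x|leb01. f x * cnj (h x))"
        using L2_norm_add_square[OF f L2_cmult[OF h, of "of_real t"]]
        by (simp add: L2_norm_cmult power_mult_distrib mult.left_commute[of _ "complex_of_real t"])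
      ultimately show ?thesis by (simp add: E_def e_def algebra_simps)
    qed
    have e_conv: "(\<lambda>n. e (u n)) \<longlonglongrightarrow> e v"
    proof (rule LIM_zero_cancel, rule Lim_null_comparison)
      have "norm (e (u n) - e v) \<le> L2_norm h * (2 * (1/2)^n)" for n
      proof -
        have "(LINT x|leb01. (v x - u n x) * cnj (h x)) =
            (LINT x|leb01. v x * cnj (h x)) - (LINT x|leb01. u n x * cnj (h x))"
          unfolding left_diff_distrib
          by (intro Bochner_Integration.integral_diff L2_mult_integrable L2_intros u v h)
        then have "e v - e (u n) = Re (LINT x|leb01. (v x - u n x) * cnj (h x))"
          by (simp add: e_def)
        also have "\<bar>\<dots>\<bar> \<le> cmod (LINT x|leb01. (v x - u n x) * cnj (h x))"
          by (rule abs_Re_le_cmod)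
        also have "\<dots> \<le> L2_norm (\<lambda>x. v x - u n x) * L2_norm (\<lambda>x. cnj (h x))"
          by (intro L2_Cauchy_Schwarz L2_intros u v h)
        also have "L2_norm (\<lambda>x. cnj (h x)) = L2_norm h" by (simp add: L2_norm_def)
        also have "L2_norm (\<lambda>x. v x - u n x) * L2_norm h \<le> (2 * (1/2)^n) * L2_norm h"
          by (intro mult_right_mono vu L2_norm_nonneg)
        finally show ?thesis by (simp add: mult.commute abs_minus_commute)
      qed
      then show "\<forall>\<^sub>F n in sequentially. norm (e (u n) - e v) \<le> L2_norm h * (2 * (1/2)^n)"
        by simp
      show "(\<lambda>n. L2_norm h * (2 * (1/2)^n)) \<longlonglongrightarrow> 0"
        by (intro tendsto_mult_right_zero LIMSEQ_power_zero) simp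
    qed
    \<comment> \<open>As m is at most E (u n + t h) and E (u n) exceeds m by less than (1/4)^n, only
      the linear quantity \<open>e (u n)\<close> has to pass to the limit, not E itself.\<close>
    have quad: "0 \<le> 2 * t * e v + t\<^sup>2 * (L2_norm h)\<^sup>2" for t
    proof (rule LIMSEQ_le_const)
      show "(\<lambda>n. (1/4)^n + 2 * t * e (u n) + t\<^sup>2 * (L2_norm h)\<^sup>2) \<longlonglongrightarrow> 2 * t * e v + t\<^sup>2 * (L2_norm h)\<^sup>2"
        using tendsto_add[OF tendsto_add[OF LIMSEQ_power_zero[of "1/4::real"]
            tendsto_mult[OF tendsto_const e_conv]] tendsto_const] by simp
      have "0 \<le> (1/4)^n + 2 * t * e (u n) + t\<^sup>2 * (L2_norm h)\<^sup>2" for n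
        using m_le[OF L2_add[OF u L2_cmult[OF h, of "of_real t"]], of n] Eu[of n]
        unfolding E_add[OF u] by linarith
      then show "\<exists>N. \<forall>n\<ge>N. 0 \<le> (1/4)^n + 2 * t * e (u n) + t\<^sup>2 * (L2_norm h)\<^sup>2" by simp
    qed
    \<comment> \<open>The added 1 keeps the step t = - e v / N defined when h has norm zero.\<close>
    define N where "N = (L2_norm h)\<^sup>2 + 1"
    have N: "N > 0" by (simp add: N_def add_nonneg_pos)
    have "0 \<le> 2 * (- e v / N) * e v + (- e v / N)\<^sup>2 * N"
      using quad[of "- e v / N"] unfolding N_def
      by (smt (verit) mult_left_mono zero_le_power2)
    also have "\<dots> = - ((e v)\<^sup>2 / N)"
      using N by (simp add: power2_eq_square field_simps)
    finally have "(e v)\<^sup>2 / N \<le> 0" by simp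
    then have "e v = 0" using N by (simp add: divide_le_0_iff)
    then show ?thesis by (simp add: e_def)
  qed
  have "(LINT x|leb01. cnj (v x) * \<phi> x) = l \<phi>" if \<phi>: "\<phi> \<in> L2" for \<phi>
  proof -
    have *: "Re (LINT x|leb01. cnj (v x) * h x) = Re (l h)" if "h \<in> L2" for h
    proof -
      have "(LINT x|leb01. cnj (v x) * h x) = cnj (LINT x|leb01. v x * cnj (h x))"
        by (simp flip: Bochner_Integration.integral_cnj)
      then show ?thesis using Re_eq[OF that] by simp
    qed
    \<comment> \<open>Imaginary parts are real parts at - i phi, so the identity for real parts
      suffices.\<close>
    have "Re (l (\<lambda>x. - \<i> * \<phi> x)) = Im (l \<phi>)" unfolding cmult[OF \<phi>] by simp
    moreover have "(LINT x|leb01. cnj (v x) * (- \<i> * \<phi> x)) = - \<i> * (LINT x|leb01. cnj (v x) * \<phi> x)"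
      by (subst integral_mult_right_zero[symmetric]) (simp add: mult.left_commute)
    ultimately have "Im (LINT x|leb01. cnj (v x) * \<phi> x) = Im (l \<phi>)"
      using *[OF L2_cmult[OF \<phi>, of "- \<i>"]] by simp
    with *[OF \<phi>] show ?thesis by (simp add: complex_eq_iff)
  qed
  then show ?thesis using that[of "\<lambda>x. cnj (v x)"] L2_cnj[OF v] by blast
qed

section \<open>Primitives on the unit interval\<close>

text \<open>Antiderivative starting at 0, written with a cut-off integrand over the fixed interval:
  dominated convergence and Fubini apply directly, and the function lives on the whole line,
  constant to the left of 0 and to the right of 1.\<close>

definition prim :: "(real \<Rightarrow> complex) \<Rightarrow> real \<Rightarrow> complex" where
  "prim f x = (LINT y|leb01. (if y < x then f y else 0))"

lemma measurable_if_less [measurable]: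
  fixes f :: "real \<Rightarrow> complex"
  assumes [measurable]: "f \<in> borel_measurable leb01"
  shows "(\<lambda>y. if y < x then f y else 0) \<in> borel_measurable leb01"
proof -
  have [measurable]: "(\<lambda>y::real. y) \<in> borel_measurable leb01"
    using id_borel_measurable_lebesgue_on[of "{0<..<1::real}"] by (simp add: id_def)
  show ?thesis by measurable
qed

lemma integrable_if_less:
  fixes f :: "real \<Rightarrow> complex"
  assumes "integrable leb01 f"
  shows "integrable leb01 (\<lambda>y. if y < x then f y else 0)"
  by (rule Bochner_Integration.integrable_bound[OF assms])
    (use assms in \<open>auto intro: measurable_if_less\<close>)

lemma AE_leb01_neq: "AE y in leb01. y \<noteq> (x::real)"
proof -
  have "AE y in lebesgue. y \<noteq> x"
    by (rule AE_I[of _ _ "{x}"]) auto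
  then show ?thesis
    by (subst AE_restrict_space_iff) auto
qed

lemma prim_le_0 [simp]: "x \<le> 0 \<Longrightarrow> prim f x = 0"
  unfolding prim_def by (subst Bochner_Integration.integral_cong[of leb01 leb01 _ "\<lambda>_. 0"]) auto

lemma prim_ge_1: "x \<ge> 1 \<Longrightarrow> prim f x = (LINT y|leb01. f y)"
  unfolding prim_def by (rule Bochner_Integration.integral_cong) auto

lemma prim_add:
  "integrable leb01 f \<Longrightarrow> integrable leb01 g \<Longrightarrow> prim (\<lambda>x. f x + g x) x = prim f x + prim g x"
  unfolding prim_def
  by (subst Bochner_Integration.integral_add[symmetric])
    (auto intro!: integrable_if_less Bochner_Integration.integral_cong)

lemma prim_cmult: "prim (\<lambda>x. c * f x) x = c * prim f x"
proof -
  have "(\<lambda>y. if y < x then c * f y else 0) = (\<lambda>y. c * (if y < x then f y else 0))" by auto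
  then show ?thesis by (simp only: prim_def integral_mult_right_zero)
qed

lemma prim_diff:
  "integrable leb01 f \<Longrightarrow> integrable leb01 g \<Longrightarrow> prim (\<lambda>x. f x - g x) x = prim f x - prim g x"
  using prim_add[of f "\<lambda>x. - 1 * g x" x] prim_cmult[of "-1" g x] by simp

lemma prim_cnj: "prim (\<lambda>x. cnj (f x)) x = cnj (prim f x)"
proof -
  have "(\<lambda>y. if y < x then cnj (f y) else 0) = (\<lambda>y. cnj (if y < x then f y else 0))" by auto
  then show ?thesis by (simp only: prim_def Bochner_Integration.integral_cnj)
qed

lemma prim_cong_AE:
  assumes "f \<in> borel_measurable leb01" "g \<in> borel_measurable leb01" "AE x in leb01. f x = g x"
  shows "prim f x = prim g x"
  unfolding prim_def
  by (intro integral_cong_AE measurable_if_less assms, use assms(3) in eventually_elim) auto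

lemma prim_const: "0 \<le> x \<Longrightarrow> x \<le> 1 \<Longrightarrow> prim (\<lambda>_. c) x = of_real x * c"
proof -
  assume x: "0 \<le> x" "x \<le> 1"
  have "prim (\<lambda>_. c) x = (LINT y|leb01. (if y \<in> {0<..<x} then c else 0))"
    unfolding prim_def by (rule Bochner_Integration.integral_cong) auto
  also have "\<dots> = (LINT y|lebesgue_on {0<..<x}. c)"
    by (rule Lebesgue_Measure.integral_restrict) (use x in auto)
  also have "\<dots> = of_real x * c"
    using x by (simp add: measure_restrict_space scaleR_conv_of_real)
  finally show ?thesis .
qed

text \<open>Dominated convergence: the cut-off integrands converge except possibly at the single
  point y = x.\<close>

lemma continuous_prim:
  assumes f: "integrable leb01 f"
  shows "continuous_on S (prim f)"
proof -
  have "isCont (prim f) x" for x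
    unfolding continuous_at_sequentially comp_def prim_def
  proof safe
    fix s :: "nat \<Rightarrow> real" assume s: "s \<longlonglongrightarrow> x"
    show "(\<lambda>n. LINT y|leb01. (if y < s n then f y else 0)) \<longlonglongrightarrow> (LINT y|leb01. (if y < x then f y else 0))"
    proof (rule integral_dominated_convergence)
      show "integrable leb01 (\<lambda>y. cmod (f y))" by (rule integrable_norm[OF f])
      show "AE y in leb01. (\<lambda>n. if y < s n then f y else 0) \<longlonglongrightarrow> (if y < x then f y else 0)"
        using AE_leb01_neq[of x]
      proof eventually_elim
        case (elim y)
        then consider "y < x" | "x < y" by linarith
        then show ?case
        proof cases
          case 1
          then have "\<forall>\<^sub>F n in sequentially. y < s n" by (rule order_tendstoD(1)[OF s])
          then have "\<forall>\<^sub>F n in sequentially. (if y < s n then f y else 0) = (if y < x then f y else 0)"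
            by eventually_elim (use 1 in simp)
          then show ?thesis by (rule tendsto_eventually)
        next
          case 2
          then have "\<forall>\<^sub>F n in sequentially. s n < y" by (rule order_tendstoD(2)[OF s])
          then have "\<forall>\<^sub>F n in sequentially. (if y < s n then f y else 0) = (if y < x then f y else 0)"
            by eventually_elim (use 2 in simp)
          then show ?thesis by (rule tendsto_eventually)
        qed
      qed
    qed (use f in \<open>auto intro!: measurable_if_less\<close>)
  qed
  then show ?thesis by (simp add: continuous_at_imp_continuous_on)
qed

lemma L2_prim: "integrable leb01 f \<Longrightarrow> prim f \<in> L2"
  by (intro L2_continuous continuous_prim)

text \<open>Fubini on the two triangles of the unit square.\<close>

lemma integral_prim_by_parts:
  assumes f: "integrable leb01 f" and g: "integrable leb01 g"
  shows "(LINT x|leb01. f x * prim g x) + (LINT x|leb01. prim f x * g x) =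
    (LINT x|leb01. f x) * (LINT x|leb01. g x)"
proof -
  interpret pair_sigma_finite leb01 leb01 by standard
  have [measurable]: "(\<lambda>y::real. y) \<in> borel_measurable leb01"
    using id_borel_measurable_lebesgue_on[of "{0<..<1::real}"] by (simp add: id_def)
  have [measurable]: "f \<in> borel_measurable leb01" "g \<in> borel_measurable leb01"
    using f g by auto
  have int: "integrable (leb01 \<Otimes>\<^sub>M leb01) (\<lambda>(x,y). f x * g y)"
  proof (rule Fubini_integrable)
    show "AE x in leb01. integrable leb01 (\<lambda>y. case (x, y) of (x, y) \<Rightarrow> f x * g y)"
      using g by simp
    show "integrable leb01 (\<lambda>x. LINT y|leb01. norm (case (x, y) of (x, y) \<Rightarrow> f x * g y))"
      using f by (simp add: norm_mult)
  qed simp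
  have int': "integrable (leb01 \<Otimes>\<^sub>M leb01) (\<lambda>(x,y). if y < x then f x * g y else 0)"
    by (rule Bochner_Integration.integrable_bound[OF int]) auto
  have "(LINT x|leb01. prim f x * g x) = (LINT y|leb01. LINT x|leb01. (if x < y then f x * g y else 0))"
    unfolding prim_def integral_mult_left_zero[symmetric]
    by (intro Bochner_Integration.integral_cong) auto
  also have "\<dots> = (LINT x|leb01. LINT y|leb01. (if x < y then f x * g y else 0))"
    by (rule Fubini_integral, rule Bochner_Integration.integrable_bound[OF int]) auto
  finally have 1: "(LINT x|leb01. prim f x * g x) = (LINT x|leb01. LINT y|leb01. (if x < y then f x * g y else 0))" .
  have 2: "(LINT x|leb01. f x * prim g x) = (LINT x|leb01. LINT y|leb01. (if y < x then f x * g y else 0))"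
    unfolding prim_def integral_mult_right_zero[symmetric]
    by (intro Bochner_Integration.integral_cong) auto
  have 3: "integrable (leb01 \<Otimes>\<^sub>M leb01) (\<lambda>(x,y). if x < y then f x * g y else 0)"
    by (rule Bochner_Integration.integrable_bound[OF int]) auto
  have "(LINT x|leb01. f x * prim g x) + (LINT x|leb01. prim f x * g x) =
     (LINT x|leb01. (LINT y|leb01. (if y < x then f x * g y else 0)) + (LINT y|leb01. (if x < y then f x * g y else 0)))"
    unfolding 1 2
    by (rule Bochner_Integration.integral_add[symmetric])
      (use integrable_fst[OF int'] integrable_fst[OF 3] in auto)
  also have "\<dots> = (LINT x|leb01. f x * (LINT y|leb01. g y))"
  proof (rule Bochner_Integration.integral_cong)
    fix x
    have i: "integrable leb01 (\<lambda>y. f x * g y)" using g by simp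
    have "(LINT y|leb01. (if y < x then f x * g y else 0)) + (LINT y|leb01. (if x < y then f x * g y else 0))
       = (LINT y|leb01. (if y < x then f x * g y else 0) + (if x < y then f x * g y else 0))"
      by (rule Bochner_Integration.integral_add[symmetric];
          rule Bochner_Integration.integrable_bound[OF i]) auto
    \<comment> \<open>The two triangles leave out only the diagonal point y = x, a null set.\<close>
    also have "\<dots> = (LINT y|leb01. f x * g y)"
      by (intro integral_cong_AE, measurable, use AE_leb01_neq[of x] in eventually_elim) auto
    finally show "(LINT y|leb01. (if y < x then f x * g y else 0)) + (LINT y|leb01. (if x < y then f x * g y else 0))
       = f x * (LINT y|leb01. g y)" by simp
  qed simp
  finally show ?thesis by simp
qed

text \<open>A function whose integrals over all measurable sets vanish is zero almost everywhere.
  The hypothesis covers half-lines, which are stable under intersection and generate the Borel sets,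
  so Dynkin induction reaches every Borel set.\<close>

lemma AE_zero_if_prim_zero:
  assumes w: "integrable leb01 w" and 0: "\<And>x. 0 \<le> x \<Longrightarrow> x \<le> 1 \<Longrightarrow> prim w x = 0"
  shows "AE x in leb01. w x = 0"
proof (rule leb01.density_zero[OF w])
  have prim0: "prim w x = 0" for x
    using 0[of x] 0[of 1] prim_ge_1[of x w] prim_ge_1[of 1 w] prim_le_0[of x w] by (cases "x \<le> 0"; cases "x \<le> 1") auto
  have w0: "(LINT x|leb01. w x) = 0" using prim_ge_1[of 1 w] prim0 by simp
  have [measurable]: "(\<lambda>y::real. y) \<in> borel_measurable leb01"
    using id_borel_measurable_lebesgue_on[of "{0<..<1::real}"] by (simp add: id_def)
  have [measurable]: "w \<in> borel_measurable leb01" using w by auto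
  have int: "integrable leb01 (\<lambda>x. indicator B x *\<^sub>R w x)" if "B \<in> sets borel" for B :: "real set"
  proof (rule Bochner_Integration.integrable_bound[OF w])
    have [measurable]: "B \<in> sets borel" by fact
    show "(\<lambda>x. indicator B x *\<^sub>R w x) \<in> borel_measurable leb01" by measurable
  qed (auto simp: indicator_def)
  have borel: "(LINT x|leb01. indicator B x *\<^sub>R w x) = 0" if "B \<in> sets borel" for B :: "real set"
  proof -
    have "Int_stable (range (lessThan :: real \<Rightarrow> _))"
      unfolding Int_stable_def
    proof safe
      fix a b :: real
      show "{..<a} \<inter> {..<b} \<in> range lessThan"
        by (rule image_eqI[of _ _ "min a b"]) auto
    qed
    moreover have "range (lessThan :: real \<Rightarrow> _) \<subseteq> Pow UNIV" by simp
    moreover have "B \<in> sigma_sets UNIV (range (lessThan :: real \<Rightarrow> _))"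
      using that unfolding borel_Iio by simp
    ultimately show ?thesis
    proof (induction rule: sigma_sets_induct_disjoint)
      case (basic A)
      then obtain a where "A = {..<a}" by auto
      then have "(LINT x|leb01. indicator A x *\<^sub>R w x) = prim w a"
        unfolding prim_def by (auto intro!: Bochner_Integration.integral_cong)
      then show ?case by (simp add: prim0)
    next
      case (compl A)
      then have A: "A \<in> sets borel" unfolding borel_Iio by simp
      have "(LINT x|leb01. indicator (UNIV - A) x *\<^sub>R w x) = (LINT x|leb01. w x - indicator A x *\<^sub>R w x)"
        by (auto intro!: Bochner_Integration.integral_cong simp: indicator_def)
      also have "\<dots> = 0"
        by (subst Bochner_Integration.integral_diff[OF w int[OF A]]) (simp add: w0 compl)
      finally show ?case .
    next
      case (union A)
      have A: "A i \<in> sets borel" for i using union(2) unfolding borel_Iio by auto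
      \<comment> \<open>Countable unions are limits of finite ones, with |w| as the dominating
        function.\<close>
      have "(\<lambda>n. LINT x|leb01. indicator (\<Union>i<n. A i) x *\<^sub>R w x) \<longlonglongrightarrow> (LINT x|leb01. indicator (\<Union>i. A i) x *\<^sub>R w x)"
      proof (rule integral_dominated_convergence)
        show "integrable leb01 (\<lambda>y. cmod (w y))" by (rule integrable_norm[OF w])
        show "AE x in leb01. (\<lambda>n. indicator (\<Union>i<n. A i) x *\<^sub>R w x) \<longlonglongrightarrow> indicator (\<Union>i. A i) x *\<^sub>R w x"
          by (intro AE_I2 tendsto_scaleR LIMSEQ_indicator_UN tendsto_const)
        show "(\<lambda>x. indicator (\<Union>i. A i) x *\<^sub>R w x) \<in> borel_measurable leb01"
          "(\<lambda>x. indicator (\<Union>i<n. A i) x *\<^sub>R w x) \<in> borel_measurable leb01" for n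
          by (rule borel_measurable_integrable, rule int, use A in auto)+
      qed (auto simp: indicator_def)
      moreover have "(LINT x|leb01. indicator (\<Union>i<n. A i) x *\<^sub>R w x) = 0" for n
      proof (induction n)
        case (Suc n)
        have disj: "(\<Union>i<n. A i) \<inter> A n = {}"
        proof -
          have "A i \<inter> A n = {}" if "i < n" for i
            using union(1) that by (simp add: disjoint_family_on_def)
          then show ?thesis by blast
        qed
        have "(LINT x|leb01. indicator (\<Union>i<Suc n. A i) x *\<^sub>R w x) =
            (LINT x|leb01. indicator (\<Union>i<n. A i) x *\<^sub>R w x + indicator (A n) x *\<^sub>R w x)"
          using disj by (intro Bochner_Integration.integral_cong) (auto simp: indicator_def lessThan_Suc)
        also have "\<dots> = 0"
          using Suc union(3)[of n] A
          by (subst Bochner_Integration.integral_add[OF int int]) (simp_all add: sets.finite_UN)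
        finally show ?case .
      qed simp
      ultimately show ?case by (simp add: LIMSEQ_const_iff)
    qed simp
  qed
  \<comment> \<open>The measure lives on Lebesgue sets; each of them is a Borel set up to a null
    set.\<close>
  fix A assume "A \<in> sets leb01"
  then have "A \<in> sets (completion lborel)"
    by (auto simp: sets_restrict_space)
  then obtain B N N' where B: "A = B \<union> N" "N \<subseteq> N'" "N' \<in> null_sets lborel" "B \<in> sets lborel"
    by (rule sets_completionE) blast
  then have "AE x in lebesgue. x \<notin> N'"
    by (intro AE_not_in null_sets_completionI)
  then have "AE x in leb01. x \<notin> N'" by (subst AE_restrict_space_iff) auto
  then have "AE x in leb01. indicator A x *\<^sub>R w x = indicator B x *\<^sub>R w x"
    by eventually_elim (use B in \<open>auto simp: indicator_def\<close>)
  then have "(LINT x|leb01. indicator A x *\<^sub>R w x) = (LINT x|leb01. indicator B x *\<^sub>R w x)"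
    using \<open>A \<in> sets leb01\<close> int[of B] B(4) by (intro integral_cong_AE) auto
  then show "set_lebesgue_integral leb01 A w = 0"
    unfolding set_lebesgue_integral_def using borel[of B] B(4) by simp
qed

section \<open>Functions in $H^1(0,1)$ as primitives\<close>

text \<open>The set of disagreement inside the open interval is open and null, hence empty; the
  endpoints follow by continuity.\<close>

lemma continuous_eq_if_AE_eq:
  fixes u v :: "real \<Rightarrow> complex"
  assumes u: "continuous_on {0..1} u" and v: "continuous_on {0..1} v"
    and ae: "AE x in leb01. u x = v x" and x: "x \<in> {0..1}"
  shows "u x = v x"
proof -
  let ?d = "\<lambda>x. u x - v x"
  have d: "continuous_on {0..1} ?d" by (intro continuous_intros u v)
  let ?S = "{x\<in>{0<..<1}. ?d x \<in> - {0}}"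
  have "continuous_on {0<..<1} ?d" by (rule continuous_on_subset[OF d]) auto
  then have "open ({0<..<1} \<inter> ?d -` (- {0}))"
    by (intro continuous_open_preimage) auto
  moreover have "{0<..<1} \<inter> ?d -` (- {0}) = ?S" by auto
  ultimately have op: "open ?S" by simp
  have "AE x in lebesgue. x \<in> {0<..<1} \<longrightarrow> u x = v x"
    using ae by (subst (asm) AE_restrict_space_iff) auto
  then have "AE x in lebesgue. x \<notin> ?S" by eventually_elim auto
  then have "?S \<in> null_sets lebesgue"
    using op by (subst AE_iff_null_sets) auto
  then have "negligible ?S" by (simp add: negligible_iff_null_sets)
  then have "?S = {}" using open_not_negligible[OF op] by blast
  then have "?d y = 0" if "y \<in> {0<..<1}" for y using that by blast
  then have "?d x = 0"
    using x d by (intro continuous_constant_on_closure[of "{0<..<1}" ?d 0 x]) auto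
  then show ?thesis by simp
qed

lemma prim_FTC:
  assumes deriv: "\<And>x. (\<phi> has_vector_derivative \<phi>' x) (at x)"
    and cont: "continuous_on UNIV \<phi>'" and x: "0 \<le> x" "x \<le> 1"
  shows "prim \<phi>' x = \<phi> x - \<phi> 0"
proof -
  have "prim \<phi>' x = (LINT y|leb01. (if y \<in> {0<..<x} then \<phi>' y else 0))"
    unfolding prim_def by (rule Bochner_Integration.integral_cong) auto
  also have "\<dots> = (LINT y|lebesgue_on {0<..<x}. \<phi>' y)"
    by (rule Lebesgue_Measure.integral_restrict) (use x in auto)
  also have "\<dots> = integral {0<..<x} \<phi>'"
  proof (rule lebesgue_integral_eq_integral)
    have "integrable (lebesgue_on {0..x}) \<phi>'"
      by (intro continuous_imp_integrable_real continuous_on_subset[OF cont]) auto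
    then have "integrable lebesgue (\<lambda>y. if y \<in> {0..x} then \<phi>' y else 0)"
      by (subst Lebesgue_Measure.integrable_restrict_UNIV) auto
    then have "integrable lebesgue (\<lambda>y. indicator {0<..<x} y *\<^sub>R (if y \<in> {0..x} then \<phi>' y else 0))"
      by (intro integrable_mult_indicator) auto
    also have "(\<lambda>y. indicator {0<..<x} y *\<^sub>R (if y \<in> {0..x} then \<phi>' y else 0)) =
        (\<lambda>y. if y \<in> {0<..<x} then \<phi>' y else 0)" by (auto simp: indicator_def)
    finally show "integrable (lebesgue_on {0<..<x}) \<phi>'"
      by (subst (asm) Lebesgue_Measure.integrable_restrict_UNIV) auto
  qed auto
  also have "\<dots> = integral {0..x} \<phi>'"
    by (rule integral_open_interval_real[symmetric])
  also have "\<dots> = \<phi> x - \<phi> 0"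
    by (intro integral_unique fundamental_theorem_of_calculus x)
      (auto intro: has_vector_derivative_at_within deriv)
  finally show ?thesis .
qed

text \<open>A test function is the primitive of its own derivative and vanishes at both ends, so in
  the integration by parts the constant c and the boundary product drop out.\<close>

lemma is_weak_deriv_prim:
  assumes f: "f \<in> borel_measurable leb01" and g: "integrable leb01 g"
    and rep: "AE x in leb01. f x = c + prim g x"
  shows "is_weak_deriv f g"
  unfolding is_weak_deriv_def
proof (intro allI impI, elim conjE)
  fix \<phi> \<phi>' :: "real \<Rightarrow> complex" and a b :: real
  assume ab: "0 < a" "b < 1" and supp: "\<forall>x. x \<notin> {a..b} \<longrightarrow> \<phi> x = 0"
    and deriv: "\<forall>x. (\<phi> has_vector_derivative \<phi>' x) (at x)" and cont: "continuous_on UNIV \<phi>'"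
  have \<phi>': "\<phi>' \<in> L2" by (intro L2_continuous continuous_on_subset[OF cont]) auto
  have \<phi>0: "\<phi> 0 = 0" "\<phi> 1 = 0" using ab supp by auto
  have prim: "prim \<phi>' x = \<phi> x" if "0 \<le> x" "x \<le> 1" for x
    using prim_FTC[of \<phi>, OF _ cont that] deriv \<phi>0 by simp
  have int0: "(LINT x|leb01. \<phi>' x) = 0" using prim[of 1] prim_ge_1[of 1 \<phi>'] \<phi>0 by simp
  have "(LINT x|leb01. f x * \<phi>' x) = (LINT x|leb01. c * \<phi>' x + prim g x * \<phi>' x)"
  proof (rule integral_cong_AE)
    show "(\<lambda>x. c * \<phi>' x + prim g x * \<phi>' x) \<in> borel_measurable leb01"
      by (intro borel_measurable_add borel_measurable_times L2_measurable L2_const L2_prim g \<phi>')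
    show "AE x in leb01. f x * \<phi>' x = c * \<phi>' x + prim g x * \<phi>' x"
      using rep by eventually_elim (simp add: algebra_simps)
  qed (intro borel_measurable_times f L2_measurable \<phi>')
  also have "\<dots> = c * (LINT x|leb01. \<phi>' x) + (LINT x|leb01. prim g x * \<phi>' x)"
    by (subst Bochner_Integration.integral_add)
      (use L2_cmult[OF \<phi>', of c, THEN L2_integrable] in \<open>auto intro: L2_mult_integrable L2_prim g \<phi>'\<close>)
  also have "\<dots> = - (LINT x|leb01. g x * prim \<phi>' x)"
    using integral_prim_by_parts[OF g L2_integrable[OF \<phi>']] by (simp add: int0 add_eq_0_iff)
  also have "(LINT x|leb01. g x * prim \<phi>' x) = (LINT x|leb01. g x * \<phi> x)"
    by (rule Bochner_Integration.integral_cong) (auto simp: prim)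
  finally show "(LINT x|leb01. f x * \<phi>' x) = - (LINT x|leb01. g x * \<phi> x)" .
qed

text \<open>
  The test functions below are differences of the regularised ramps $R_n$, whose derivatives $r_n$
  tend to the indicator of the positive half line.
\<close>

lemma du_Bois_Reymond:
  assumes u: "integrable leb01 u" and weak: "is_weak_deriv u (\<lambda>_. 0)"
  obtains C where "AE x in leb01. u x = C"
proof -
  \<comment> \<open>The primitive of the positive part; it is C^1, which is what the class of test
    functions demands.\<close>
  define q :: "real \<Rightarrow> real" where "q z = (max 0 z)\<^sup>2 / 2" for z
  have q: "(q has_real_derivative max 0 z) (at z)" for z
  proof (cases z "0::real" rule: linorder_cases)
    case less
    have "((\<lambda>z. 0) has_real_derivative 0) (at z)" by simp
    then have "(q has_real_derivative 0) (at z)"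
      by (rule has_field_derivative_transform_within_open[of _ _ _ "{..<0}"])
        (use less in \<open>auto simp: q_def\<close>)
    with less show ?thesis by simp
  next
    case equal
    have "((\<lambda>h. (q (0 + h) - q 0) / h) \<longlongrightarrow> 0) (at 0)"
    proof (rule Lim_null_comparison)
      have "norm ((q (0 + h) - q 0) / h) \<le> \<bar>h\<bar>" for h
        by (auto simp: q_def max_def power2_eq_square)
      then show "\<forall>\<^sub>F h in at 0. norm ((q (0 + h) - q 0) / h) \<le> \<bar>h\<bar>" by simp
      show "((\<lambda>h::real. \<bar>h\<bar>) \<longlongrightarrow> 0) (at 0)" by (intro tendsto_rabs_zero tendsto_ident_at)
    qed
    with equal show ?thesis by (simp add: DERIV_def)
  next
    case greater
    have "((\<lambda>z. z\<^sup>2 / 2) has_real_derivative z) (at z)"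
      by (auto intro!: derivative_eq_intros)
    then have "(q has_real_derivative z) (at z)"
      by (rule has_field_derivative_transform_within_open[of _ _ _ "{0<..}"])
        (use greater in \<open>auto simp: q_def\<close>)
    with greater show ?thesis by simp
  qed
  \<comment> \<open>\<open>R n\<close> is zero for z <= 0 and has slope 1 beyond 1/(n+1); its
    derivative \<open>r n\<close> rises linearly from 0 to 1 in between.\<close>
  define R where "R n z = real (Suc n) * (q z - q (z - 1 / real (Suc n)))" for n z
  define r where "r n z = real (Suc n) * (max 0 z - max 0 (z - 1 / real (Suc n)))" for n z
  have R_deriv: "((\<lambda>x. R n (x - s)) has_real_derivative r n (x - s)) (at x)" for n x s
    unfolding R_def r_def by (auto intro!: derivative_eq_intros DERIV_chain2[OF q])
  have r_cont: "continuous_on S (\<lambda>x. r n (x - s))" for S n s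
    unfolding r_def by (intro continuous_intros)
  have pos: "1 / real (Suc n) > 0" for n by simp
  have R_neg: "R n z = 0" if "z \<le> 0" for n z
  proof -
    have "max 0 z = 0" "max 0 (z - 1 / real (Suc n)) = 0" using that pos[of n] by linarith+
    then show ?thesis by (simp only: R_def q_def) simp
  qed
  \<comment> \<open>The offset 1/(2(n+1)) does not depend on z, so it cancels in differences of
    ramps.\<close>
  have R_pos: "R n z = z - 1 / (2 * real (Suc n))" if "z \<ge> 1 / real (Suc n)" for n z
  proof -
    define N where "N = real (Suc n)"
    have "N > 0" by (simp add: N_def)
    have "max 0 z = z" "max 0 (z - 1 / N) = z - 1 / N"
      using that pos[of n] unfolding N_def by linarith+
    then have "R n z = N * (z\<^sup>2 / 2 - (z - 1 / N)\<^sup>2 / 2)" by (simp only: R_def q_def N_def)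
    also have "\<dots> = z - 1 / (2 * N)"
      using \<open>N > 0\<close> by (simp add: power2_eq_square field_simps)
    finally show ?thesis by (simp only: N_def)
  qed
  have r_bound: "\<bar>r n z\<bar> \<le> 1" for n z
  proof -
    define d where "d = max 0 z - max 0 (z - 1 / real (Suc n))"
    have "0 \<le> d" "d \<le> 1 / real (Suc n)" unfolding d_def using pos[of n] by linarith+
    moreover from this(2) have "real (Suc n) * d \<le> 1" by (simp add: field_simps del: of_nat_Suc)
    ultimately show ?thesis by (simp add: r_def d_def[symmetric] del: of_nat_Suc)
  qed
  have r_lim: "(\<lambda>n. r n z) \<longlonglongrightarrow> (if z > 0 then 1 else 0)" for z
  proof (cases "z > 0")
    case True
    have "\<forall>\<^sub>F n in sequentially. 1 / real (Suc n) < z"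
      by (rule order_tendstoD(2)[OF LIMSEQ_Suc[OF lim_1_over_n] True])
    then have "\<forall>\<^sub>F n in sequentially. r n z = 1"
      by eventually_elim (use True in \<open>simp add: r_def max_def field_simps del: of_nat_Suc\<close>)
    with True show ?thesis by (simp add: tendsto_eventually)
  next
    case False
    have "r n z = 0" for n
    proof -
      have "max 0 z = 0" "max 0 (z - 1 / real (Suc n)) = 0" using False pos[of n] by linarith+
      then show ?thesis by (simp only: r_def) simp
    qed
    with False show ?thesis by simp
  qed
  define T where "T n s = (LINT x|leb01. u x * of_real (r n (x - s)))" for n s
  have T_int: "integrable leb01 (\<lambda>x. u x * of_real (r n (x - s)))" for n s
  proof (rule Bochner_Integration.integrable_bound[OF u])
    show "(\<lambda>x. u x * of_real (r n (x - s))) \<in> borel_measurable leb01"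
      by (rule borel_measurable_times[OF borel_measurable_integrable[OF u] measurable_leb01_continuous])
        (intro continuous_intros r_cont)
  qed (auto simp: norm_mult intro!: mult_left_le r_bound)
  have T_lim: "(\<lambda>n. T n s) \<longlonglongrightarrow> (LINT x|leb01. u x) - prim u s" for s
  proof -
    have "(\<lambda>n. T n s) \<longlonglongrightarrow> (LINT x|leb01. u x - (if x < s then u x else 0))"
      unfolding T_def
    proof (rule integral_dominated_convergence)
      show "integrable leb01 (\<lambda>y. cmod (u y))" by (rule integrable_norm[OF u])
      show "AE x in leb01. (\<lambda>n. u x * of_real (r n (x - s))) \<longlonglongrightarrow> u x - (if x < s then u x else 0)"
        using AE_leb01_neq[of s]
      proof eventually_elim
        case (elim x)
        have "(\<lambda>n. u x * of_real (r n (x - s))) \<longlonglongrightarrow> u x * of_real (if x - s > 0 then 1 else 0)"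
          by (intro tendsto_intros r_lim)
        with elim show ?case by (cases "x < s") auto
      qed
      show "AE x in leb01. norm (u x * of_real (r n (x - s))) \<le> cmod (u x)" for n
        by (auto simp: norm_mult intro!: mult_left_le r_bound)
    qed (use T_int u in \<open>auto intro!: measurable_if_less\<close>)
    also have "(LINT x|leb01. u x - (if x < s then u x else 0)) = (LINT x|leb01. u x) - prim u s"
      unfolding prim_def by (rule Bochner_Integration.integral_diff[OF u integrable_if_less[OF u]])
    finally show ?thesis .
  qed
  \<comment> \<open>Equal slopes of \<open>prim u\<close> over all subintervals. The difference of
    the ramps started at s and t levels off at height t - s; the two weights cancel the heights of
    two such differences, so that the combination has compact support.\<close>
  have main: "of_real (t' - s') * (prim u t - prim u s) = of_real (t - s) * (prim u t' - prim u s')"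
    if st: "0 < s" "s < t" "t < 1" and st': "0 < s'" "s' < t'" "t' < 1" for s t s' t'
  proof -
    define b where "b = max t t'"
    have b: "b < 1" "t \<le> b" "t' \<le> b" using st st' by (auto simp: b_def)
    \<comment> \<open>For such n every ramp has reached slope 1 before the right end, so the support
      stays inside the open interval.\<close>
    have "\<forall>\<^sub>F n in sequentially. 1 / real (Suc n) < 1 - b"
      by (rule order_tendstoD(2)[OF LIMSEQ_Suc[OF lim_1_over_n]]) (use b in simp)
    then have ev: "\<forall>\<^sub>F n in sequentially. of_real (t' - s') * (T n s - T n t) - of_real (t - s) * (T n s' - T n t') = 0"
    proof eventually_elim
      case (elim n)
      define \<phi> where "\<phi> x = (t' - s') * (R n (x - s) - R n (x - t)) - (t - s) * (R n (x - s') - R n (x - t'))" for x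
      define \<phi>' where "\<phi>' x = (t' - s') * (r n (x - s) - r n (x - t)) - (t - s) * (r n (x - s') - r n (x - t'))" for x
      have "(\<phi> has_real_derivative \<phi>' x) (at x)" for x
        unfolding \<phi>_def \<phi>'_def by (intro DERIV_diff DERIV_cmult R_deriv)
      then have "((\<lambda>x. of_real (\<phi> x) :: complex) has_vector_derivative of_real (\<phi>' x)) (at x)" for x
        by (intro has_vector_derivative_of_real) (simp add: has_real_derivative_iff_has_vector_derivative)
      moreover have "continuous_on UNIV (\<lambda>x. of_real (\<phi>' x) :: complex)"
        unfolding \<phi>'_def by (intro continuous_intros r_cont)
      moreover have "of_real (\<phi> x) = (0 :: complex)" if "x \<notin> {min s s'..b + 1 / real (Suc n)}" for x
      proof (cases "x < min s s'")
        case True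
        then show ?thesis using st st' by (simp add: \<phi>_def R_neg)
      next
        case False
        then have "x > b + 1 / real (Suc n)" using that by auto
        then have "R n (x - y) = (x - y) - 1 / (2 * real (Suc n))" if "y \<le> b" for y
          using that by (intro R_pos) linarith
        then have e: "R n (x - s) = (x - s) - 1 / (2 * real (Suc n))"
            "R n (x - t) = (x - t) - 1 / (2 * real (Suc n))"
            "R n (x - s') = (x - s') - 1 / (2 * real (Suc n))"
            "R n (x - t') = (x - t') - 1 / (2 * real (Suc n))"
          using b st st' by auto
        define d where "d = 1 / (2 * real (Suc n))"
        have "\<phi> x = (t' - s') * ((x - s - d) - (x - t - d)) - (t - s) * ((x - s' - d) - (x - t' - d))"
          by (simp only: \<phi>_def e d_def)
        also have "\<dots> = 0" by algebra
        finally have "\<phi> x = 0" .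
        then show ?thesis by simp
      qed
      ultimately have "(LINT x|leb01. u x * of_real (\<phi>' x)) = - (LINT x|leb01. 0 * of_real (\<phi> x))"
        using weak elim st st' unfolding is_weak_deriv_def
        by (intro weak[unfolded is_weak_deriv_def, rule_format, of "min s s'" "b + 1 / real (Suc n)"]) auto
      moreover have "(LINT x|leb01. u x * of_real (\<phi>' x)) =
          of_real (t' - s') * (T n s - T n t) - of_real (t - s) * (T n s' - T n t')"
      proof -
        have "(LINT x|leb01. u x * of_real (\<phi>' x)) = (LINT x|leb01.
          of_real (t' - s') * (u x * of_real (r n (x - s)) - u x * of_real (r n (x - t))) -
          of_real (t - s) * (u x * of_real (r n (x - s')) - u x * of_real (r n (x - t'))))"
          by (intro Bochner_Integration.integral_cong refl) (simp add: \<phi>'_def algebra_simps)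
        also have "\<dots> = of_real (t' - s') * (T n s - T n t) - of_real (t - s) * (T n s' - T n t')"
          unfolding T_def using T_int by simp
        finally show ?thesis .
      qed
      ultimately show ?case by simp
    qed
    let ?U = "LINT x|leb01. u x"
    have "(\<lambda>n. of_real (t' - s') * (T n s - T n t) - of_real (t - s) * (T n s' - T n t')) \<longlonglongrightarrow>
       of_real (t' - s') * ((?U - prim u s) - (?U - prim u t)) - of_real (t - s) * ((?U - prim u s') - (?U - prim u t'))"
      by (intro tendsto_intros T_lim)
    moreover have "(\<lambda>n. of_real (t' - s') * (T n s - T n t) - of_real (t - s) * (T n s' - T n t')) \<longlonglongrightarrow> 0"
      using ev by (rule tendsto_eventually)
    ultimately have "of_real (t' - s') * ((?U - prim u s) - (?U - prim u t)) - of_real (t - s) * ((?U - prim u s') - (?U - prim u t')) = 0"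
      by (rule LIMSEQ_unique)
    then show ?thesis by (simp add: algebra_simps)
  qed
  \<comment> \<open>The slope of \<open>prim u\<close> over [1/3, 2/3]; by \<open>main\<close> it is
    the slope over every subinterval.\<close>
  define C where "C = 3 * (prim u (2/3) - prim u (1/3))"
  let ?w = "\<lambda>x. u x - C"
  have w: "integrable leb01 ?w" using u by simp
  have prim_w: "prim ?w x = prim u x - of_real x * C" if "0 \<le> x" "x \<le> 1" for x
    using prim_diff[of u "\<lambda>_. C" x] u prim_const[OF that, of C] by simp
  have step: "prim ?w t = prim ?w s" if "0 < s" "s < t" "t < 1" for s t
  proof -
    have "prim u t - prim u s = of_real (t - s) * C"
      using main[OF that, of "1/3" "2/3"] by (simp add: C_def field_simps)
    then have "prim u t = prim u s + of_real (t - s) * C" by (simp add: diff_eq_eq)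
    moreover have "prim ?w s = prim u s - of_real s * C" "prim ?w t = prim u t - of_real t * C"
      using that prim_w by auto
    ultimately show ?thesis by (simp only: of_real_diff) (simp add: algebra_simps)
  qed
  have const: "prim ?w x = prim ?w (1/2)" if "x \<in> {0<..<1}" for x
  proof -
    consider "x < 1/2" | "x = 1/2" | "1/2 < x" by linarith
    then show ?thesis
    proof cases
      case 1
      show ?thesis by (rule step[symmetric]) (use 1 that in auto)
    next
      case 2
      show ?thesis by (simp only: 2)
    next
      case 3
      show ?thesis by (rule step) (use 3 that in auto)
    qed
  qed
  define k where "k = prim ?w (1/2)"
  have const': "prim ?w x = k" if "0 \<le> x" "x \<le> 1" for x
  proof (rule continuous_constant_on_closure[of "{0<..<1::real}" "prim ?w" k x])
    show "continuous_on (closure {0<..<1}) (prim ?w)" by (rule continuous_prim[OF w])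
    show "prim ?w y = k" if "y \<in> {0<..<1}" for y using const[OF that] by (simp only: k_def)
    show "x \<in> closure {0<..<1}" using that by simp
  qed
  \<comment> \<open>The constant is read off at 0, where every primitive vanishes.\<close>
  have "prim ?w x = 0" if "0 \<le> x" "x \<le> 1" for x
    using const'[OF that] const'[of 0] by simp
  then have "AE x in leb01. ?w x = 0" by (rule AE_zero_if_prim_zero[OF w])
  then show ?thesis by (intro that[of C]) auto
qed

text \<open>Subtracting \<open>prim g\<close>, which has weak derivative g, leaves a function with
  weak derivative zero, and this is constant by the lemma of du Bois-Reymond.\<close>

lemma weak_deriv_rep:
  assumes f: "f \<in> L2" and g: "g \<in> L2" and fg: "is_weak_deriv f g"
  obtains c where "AE x in leb01. f x = c + prim g x"
proof -
  have ig: "integrable leb01 g" by (rule L2_integrable[OF g])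
  let ?u = "\<lambda>x. f x - prim g x"
  have u: "?u \<in> L2" by (intro L2_diff f L2_prim ig)
  have g': "is_weak_deriv (prim g) g"
    by (rule is_weak_deriv_prim[where c = 0]) (auto intro: L2_measurable L2_prim ig)
  have "is_weak_deriv ?u (\<lambda>_. 0)"
    unfolding is_weak_deriv_def
  proof (intro allI impI)
    fix \<phi> \<phi>' :: "real \<Rightarrow> complex" and a b :: real
    assume *: "0 < a \<and> b < 1 \<and> (\<forall>x. x \<notin> {a..b} \<longrightarrow> \<phi> x = 0) \<and>
        (\<forall>x. (\<phi> has_vector_derivative \<phi>' x) (at x)) \<and> continuous_on UNIV \<phi>'"
    then have "\<phi>' \<in> L2" by (intro L2_continuous) (auto intro: continuous_on_subset)
    then have "(LINT x|leb01. ?u x * \<phi>' x) = (LINT x|leb01. f x * \<phi>' x) - (LINT x|leb01. prim g x * \<phi>' x)"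
      unfolding left_diff_distrib
      by (intro Bochner_Integration.integral_diff L2_mult_integrable f L2_prim ig)
    also have "\<dots> = 0"
      using fg[unfolded is_weak_deriv_def, rule_format, OF *] g'[unfolded is_weak_deriv_def, rule_format, OF *]
      by simp
    finally show "(LINT x|leb01. ?u x * \<phi>' x) = - (LINT x|leb01. 0 * \<phi> x)" by simp
  qed
  from du_Bois_Reymond[OF L2_integrable[OF u] this]
  obtain C where "AE x in leb01. ?u x = C" by blast
  then have "AE x in leb01. f x = C + prim g x" by eventually_elim (simp add: algebra_simps)
  then show ?thesis by (rule that)
qed

text \<open>The definite description in \<open>crep\<close> is resolved by
  \<open>continuous_eq_if_AE_eq\<close> on [0,1] and by the zero extension outside.\<close>

lemma crep_eq:
  assumes g: "integrable leb01 g" and rep: "AE x in leb01. f x = c + prim g x"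
  shows "crep f = (\<lambda>x. if x \<in> {0..1} then c + prim g x else 0)"
  unfolding crep_def
proof (rule the_equality)
  let ?u = "\<lambda>x. if x \<in> {0..1} then c + prim g x else 0"
  have "continuous_on {0..1} (\<lambda>x. c + prim g x)"
    by (intro continuous_intros continuous_prim g)
  then have cont: "continuous_on {0..1} ?u"
    by (rule continuous_on_cong[THEN iffD1, rotated 2]) auto
  have ae: "AE x in leb01. ?u x = f x"
    using rep AE_space by eventually_elim auto
  show "continuous_on {0..1} ?u \<and> (AE x in leb01. ?u x = f x) \<and> (\<forall>x. x \<notin> {0..1} \<longrightarrow> ?u x = 0)"
    using cont ae by auto
  fix u assume u: "continuous_on {0..1} u \<and> (AE x in leb01. u x = f x) \<and> (\<forall>x. x \<notin> {0..1} \<longrightarrow> u x = 0)"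
  have "AE x in leb01. u x = ?u x"
    using ae u by (auto elim: AE_mp)
  then show "u = ?u"
    using continuous_eq_if_AE_eq[of u ?u] cont u by (intro ext) fastforce
qed

text \<open>The chosen \<open>weak_deriv f\<close> gives a second representation of f as constant
  plus primitive. Both yield the same \<open>crep f\<close>, so the difference of the two
  derivatives has zero primitive and is itself zero almost everywhere.\<close>

lemma
  assumes f: "f \<in> L2" and g: "g \<in> L2" and rep: "AE x in leb01. f x = c + prim g x"
  shows H1I: "f \<in> H1" and crep_0_eq: "crep f 0 = c" and crep_1_eq: "crep f 1 = c + (LINT x|leb01. g x)"
    and weak_deriv_eq: "AE x in leb01. weak_deriv f x = g x"
proof -
  have ig: "integrable leb01 g" by (rule L2_integrable[OF g])
  have fg: "is_weak_deriv f g" by (rule is_weak_deriv_prim[OF L2_measurable[OF f] ig rep])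
  then show "f \<in> H1" using f g by (auto simp: H1_def)
  show "crep f 0 = c" "crep f 1 = c + (LINT x|leb01. g x)"
    by (simp_all add: crep_eq[OF ig rep] prim_ge_1)
  have "weak_deriv f \<in> L2 \<and> is_weak_deriv f (weak_deriv f)"
    unfolding weak_deriv_def by (rule someI[of _ g]) (use fg g in simp)
  then have wd: "weak_deriv f \<in> L2" and "is_weak_deriv f (weak_deriv f)" by auto
  from weak_deriv_rep[OF f this] obtain d where d: "AE x in leb01. f x = d + prim (weak_deriv f) x"
    by blast
  let ?w = "\<lambda>x. weak_deriv f x - g x"
  have iw: "integrable leb01 ?w" by (intro L2_integrable L2_diff wd g)
  have eq: "c + prim g x = d + prim (weak_deriv f) x" if "x \<in> {0..1}" for x
    using fun_cong[OF crep_eq[OF ig rep], of x] fun_cong[OF crep_eq[OF L2_integrable[OF wd] d], of x] that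
    by simp
  have "prim ?w x = 0" if "0 \<le> x" "x \<le> 1" for x
    using eq[of x] eq[of 0] that by (simp add: prim_diff[OF L2_integrable[OF wd] ig])
  then have "AE x in leb01. ?w x = 0" by (rule AE_zero_if_prim_zero[OF iw])
  then show "AE x in leb01. weak_deriv f x = g x" by eventually_elim simp
qed

text \<open>Converse of the preceding criterion: \<open>weak_deriv_rep\<close> supplies a
  representation, whose constant must be the value at 0.\<close>

lemma
  assumes f: "f \<in> H1"
  shows H1_L2: "f \<in> L2" and weak_deriv_L2: "weak_deriv f \<in> L2"
    and H1_rep: "AE x in leb01. f x = crep f 0 + prim (weak_deriv f) x"
    and crep_1: "crep f 1 = crep f 0 + (LINT x|leb01. weak_deriv f x)"
proof -
  show f2: "f \<in> L2" using f by (simp add: H1_def)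
  from f obtain g where g: "g \<in> L2 \<and> is_weak_deriv f g" by (auto simp: H1_def)
  then have "weak_deriv f \<in> L2 \<and> is_weak_deriv f (weak_deriv f)"
    unfolding weak_deriv_def by (rule someI[of _ g])
  then have wd: "weak_deriv f \<in> L2" and is_wd: "is_weak_deriv f (weak_deriv f)" by auto
  show "weak_deriv f \<in> L2" by (rule wd)
  from weak_deriv_rep[OF f2 wd is_wd] obtain c where c: "AE x in leb01. f x = c + prim (weak_deriv f) x"
    by blast
  note * = crep_0_eq[OF f2 wd c] crep_1_eq[OF f2 wd c]
  show "AE x in leb01. f x = crep f 0 + prim (weak_deriv f) x"
    "crep f 1 = crep f 0 + (LINT x|leb01. weak_deriv f x)"
    using c * by simp_all
qed

section \<open>Linear operations, null sets and integration by parts in H^1(0,1)\<close>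

lemma
  assumes f: "f \<in> H1" and g: "g \<in> H1"
  shows H1_add: "(\<lambda>x. f x + g x) \<in> H1"
    and crep_add_0: "crep (\<lambda>x. f x + g x) 0 = crep f 0 + crep g 0"
    and crep_add_1: "crep (\<lambda>x. f x + g x) 1 = crep f 1 + crep g 1"
    and weak_deriv_add: "AE x in leb01. weak_deriv (\<lambda>x. f x + g x) x = weak_deriv f x + weak_deriv g x"
proof -
  have "AE x in leb01. f x + g x = (crep f 0 + crep g 0) + prim (\<lambda>x. weak_deriv f x + weak_deriv g x) x"
    using H1_rep[OF f] H1_rep[OF g]
    by eventually_elim (simp add: prim_add f g weak_deriv_L2 L2_integrable)
  note * = L2_add[OF H1_L2[OF f] H1_L2[OF g]] L2_add[OF weak_deriv_L2[OF f] weak_deriv_L2[OF g]] this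
  show "(\<lambda>x. f x + g x) \<in> H1" "crep (\<lambda>x. f x + g x) 0 = crep f 0 + crep g 0"
     "AE x in leb01. weak_deriv (\<lambda>x. f x + g x) x = weak_deriv f x + weak_deriv g x"
    using H1I[OF *] crep_0_eq[OF *] weak_deriv_eq[OF *] by simp_all
  show "crep (\<lambda>x. f x + g x) 1 = crep f 1 + crep g 1"
    using crep_1_eq[OF *] f g by (simp add: crep_1 L2_integrable weak_deriv_L2)
qed

lemma
  assumes f: "f \<in> H1"
  shows H1_cmult: "(\<lambda>x. c * f x) \<in> H1"
    and crep_cmult_0: "crep (\<lambda>x. c * f x) 0 = c * crep f 0"
    and crep_cmult_1: "crep (\<lambda>x. c * f x) 1 = c * crep f 1"
    and weak_deriv_cmult: "AE x in leb01. weak_deriv (\<lambda>x. c * f x) x = c * weak_deriv f x"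
proof -
  have "AE x in leb01. c * f x = c * crep f 0 + prim (\<lambda>x. c * weak_deriv f x) x"
    using H1_rep[OF f] by eventually_elim (simp add: prim_cmult algebra_simps)
  note * = L2_cmult[OF H1_L2[OF f], of c] L2_cmult[OF weak_deriv_L2[OF f], of c] this
  show "(\<lambda>x. c * f x) \<in> H1" "crep (\<lambda>x. c * f x) 0 = c * crep f 0"
     "AE x in leb01. weak_deriv (\<lambda>x. c * f x) x = c * weak_deriv f x"
    using H1I[OF *] crep_0_eq[OF *] weak_deriv_eq[OF *] by simp_all
  show "crep (\<lambda>x. c * f x) 1 = c * crep f 1"
    using crep_1_eq[OF *] f by (simp add: crep_1 algebra_simps)
qed

lemma H1_const: "(\<lambda>x. c) \<in> H1"
    and crep_const_0: "crep (\<lambda>x. c) 0 = c"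
    and crep_const_1: "crep (\<lambda>x. c) 1 = c"
    and weak_deriv_const: "AE x in leb01. weak_deriv (\<lambda>x. c) x = 0"
proof -
  have "AE x in leb01. c = c + prim (\<lambda>_. 0) x" by (simp add: prim_def)
  note * = L2_const[of c] L2_const[of 0] this
  show "(\<lambda>x. c) \<in> H1" "crep (\<lambda>x. c) 0 = c" "crep (\<lambda>x. c) 1 = c"
    "AE x in leb01. weak_deriv (\<lambda>x. c) x = 0"
    using H1I[OF *] crep_0_eq[OF *] crep_1_eq[OF *] weak_deriv_eq[OF *] by simp_all
qed

lemma weak_deriv_cong_AE:
  assumes f: "f \<in> H1" and g: "g \<in> borel_measurable leb01" and ae: "AE x in leb01. g x = f x"
  shows "AE x in leb01. weak_deriv g x = weak_deriv f x"
proof -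
  have "AE x in leb01. g x = crep f 0 + prim (weak_deriv f) x"
    using ae H1_rep[OF f] by eventually_elim simp
  then show ?thesis
    by (rule weak_deriv_eq[OF L2_cong_AE[OF H1_L2[OF f] g ae] weak_deriv_L2[OF f]])
qed

text \<open>Inserting constant plus primitive for both functions reduces this to
  \<open>integral_prim_by_parts\<close>; it serves the trace estimate behind
  \<open>delta1\<close>.\<close>

lemma H1_by_parts:
  assumes f: "f \<in> H1" and g: "g \<in> H1"
  shows "(LINT x|leb01. weak_deriv f x * g x) + (LINT x|leb01. f x * weak_deriv g x) =
    crep f 1 * crep g 1 - crep f 0 * crep g 0"
proof -
  note l2 = H1_L2[OF f] H1_L2[OF g] weak_deriv_L2[OF f] weak_deriv_L2[OF g]
  note i = l2(3,4)[THEN L2_integrable]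
  have 1: "(LINT x|leb01. weak_deriv f x * g x) =
      crep g 0 * (LINT x|leb01. weak_deriv f x) + (LINT x|leb01. weak_deriv f x * prim (weak_deriv g) x)"
  proof -
    have "(LINT x|leb01. weak_deriv f x * g x) =
        (LINT x|leb01. crep g 0 * weak_deriv f x + weak_deriv f x * prim (weak_deriv g) x)"
      by (intro integral_cong_AE borel_measurable_add borel_measurable_times L2_measurable l2 L2_const L2_prim i)
        (use H1_rep[OF g] in \<open>eventually_elim, simp add: algebra_simps\<close>)
    then show ?thesis
      by (simp add: L2_mult_integrable L2_prim l2 i)
  qed
  have 2: "(LINT x|leb01. f x * weak_deriv g x) =
      crep f 0 * (LINT x|leb01. weak_deriv g x) + (LINT x|leb01. prim (weak_deriv f) x * weak_deriv g x)"
  proof -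
    have "(LINT x|leb01. f x * weak_deriv g x) =
        (LINT x|leb01. crep f 0 * weak_deriv g x + prim (weak_deriv f) x * weak_deriv g x)"
      by (intro integral_cong_AE borel_measurable_add borel_measurable_times L2_measurable l2 L2_const L2_prim i)
        (use H1_rep[OF f] in \<open>eventually_elim, simp add: algebra_simps\<close>)
    then show ?thesis
      by (simp add: L2_mult_integrable L2_prim l2 i)
  qed
  show ?thesis
    unfolding 1 2 crep_1[OF f] crep_1[OF g]
    using integral_prim_by_parts[OF i] by (simp add: algebra_simps)
qed

section \<open>The dual space $H^{-1}(T)$ and the operator $P$\<close>

lemma H1T_imp_H1: "u \<in> H1T \<Longrightarrow> u \<in> H1"
  by (simp add: H1T_def)

lemma H10_imp_H1T: "u \<in> H10 \<Longrightarrow> u \<in> H1T"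
  by (simp add: H1T_def H10_def)

lemma H1T_add: "u \<in> H1T \<Longrightarrow> v \<in> H1T \<Longrightarrow> (\<lambda>x. u x + v x) \<in> H1T"
  by (simp add: H1T_def H1_add crep_add_0 crep_add_1)

lemma H1T_cmult: "u \<in> H1T \<Longrightarrow> (\<lambda>x. c * u x) \<in> H1T"
  by (simp add: H1T_def H1_cmult crep_cmult_0 crep_cmult_1)

lemma H1T_const: "(\<lambda>x. c) \<in> H1T"
  by (simp add: H1T_def H1_const crep_const_0 crep_const_1)

lemma dual_on_add: "w \<in> dual_on S \<Longrightarrow> u \<in> S \<Longrightarrow> v \<in> S \<Longrightarrow> w (\<lambda>x. u x + v x) = w u + w v"
  and dual_on_cmult: "w \<in> dual_on S \<Longrightarrow> u \<in> S \<Longrightarrow> w (\<lambda>x. c * u x) = c * w u"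
  and dual_on_outside: "w \<in> dual_on S \<Longrightarrow> u \<notin> S \<Longrightarrow> w u = 0"
  by (auto simp: dual_on_def)

lemma H1_norm_nonneg: "0 \<le> H1_norm u"
  by (simp add: H1_norm_def)

lemma L2_norm_le_H1_norm: "L2_norm u \<le> H1_norm u"
  and L2_norm_weak_deriv_le_H1_norm: "L2_norm (weak_deriv u) \<le> H1_norm u"
  by (auto simp: H1_norm_def intro: real_le_rsqrt)

lemma dual_on_bound:
  assumes "w \<in> dual_on S"
  obtains C where "C \<ge> 0" "\<And>u. u \<in> S \<Longrightarrow> cmod (w u) \<le> C * H1_norm u"
proof -
  from assms obtain C where C: "\<forall>u\<in>S. cmod (w u) \<le> C * H1_norm u"
    by (auto simp: dual_on_def)
  have "cmod (w u) \<le> \<bar>C\<bar> * H1_norm u" if "u \<in> S" for u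
    using C[rule_format, OF that] mult_right_mono[OF abs_ge_self H1_norm_nonneg, of C u] by linarith
  then show ?thesis by (intro that[of "\<bar>C\<bar>"]) auto
qed

lemma dual_on_lincomb:
  assumes w1: "w1 \<in> dual_on S" and w2: "w2 \<in> dual_on S"
  shows "(\<lambda>v. a * w1 v + b * w2 v) \<in> dual_on S"
proof -
  obtain C1 where C1: "C1 \<ge> 0" "\<And>u. u \<in> S \<Longrightarrow> cmod (w1 u) \<le> C1 * H1_norm u"
    using dual_on_bound[OF w1] by blast
  obtain C2 where C2: "C2 \<ge> 0" "\<And>u. u \<in> S \<Longrightarrow> cmod (w2 u) \<le> C2 * H1_norm u"
    using dual_on_bound[OF w2] by blast
  have "cmod (a * w1 u + b * w2 u) \<le> (cmod a * C1 + cmod b * C2) * H1_norm u" if "u \<in> S" for u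
  proof -
    have "cmod (a * w1 u + b * w2 u) \<le> cmod a * cmod (w1 u) + cmod b * cmod (w2 u)"
      using norm_triangle_ineq[of "a * w1 u" "b * w2 u"] by (simp add: norm_mult)
    also have "\<dots> \<le> cmod a * (C1 * H1_norm u) + cmod b * (C2 * H1_norm u)"
      by (intro add_mono mult_left_mono C1 C2 that norm_ge_zero)
    finally show ?thesis by (simp add: algebra_simps)
  qed
  then have "\<exists>C. \<forall>u\<in>S. cmod (a * w1 u + b * w2 u) \<le> C * H1_norm u" by blast
  then show ?thesis
    using w1 w2 unfolding dual_on_def by (auto simp: algebra_simps)
qed

text \<open>Boundedness makes a functional blind to null sets: u - v vanishes almost everywhere, so
  does its weak derivative, and its H^1 norm is zero.\<close>

lemma Hm1T_cong_AE:
  assumes w: "w \<in> Hm1T" and u: "u \<in> H1T" and v: "v \<in> H1T" and ae: "AE x in leb01. u x = v x"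
  shows "w u = w v"
proof -
  let ?d = "\<lambda>x. u x + - 1 * v x"
  have d: "?d \<in> H1T" by (intro H1T_add H1T_cmult u v)
  have "w ?d = w u - w v"
    using dual_on_add[OF w u H1T_cmult[OF v, of "-1"]] dual_on_cmult[OF w v, of "-1"] by simp
  moreover have "w ?d = 0"
  proof -
    note meas = L2_measurable[OF H1_L2[OF H1T_imp_H1[OF d]]]
    have d0: "AE x in leb01. ?d x = 0" using ae by eventually_elim simp
    have "AE x in leb01. weak_deriv ?d x = weak_deriv (\<lambda>_. 0) x"
      by (rule weak_deriv_cong_AE[OF H1_const meas d0])
    with weak_deriv_const[of 0] have d1: "AE x in leb01. weak_deriv ?d x = 0"
      by eventually_elim simp
    have "L2_norm ?d = L2_norm (\<lambda>_. 0)"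
      by (rule L2_norm_cong_AE[OF meas L2_measurable[OF L2_const] d0])
    moreover have "L2_norm (weak_deriv ?d) = L2_norm (\<lambda>_. 0)"
      by (rule L2_norm_cong_AE[OF L2_measurable[OF weak_deriv_L2[OF H1T_imp_H1[OF d]]] L2_measurable[OF L2_const] d1])
    ultimately have "H1_norm ?d = 0" by (simp add: H1_norm_def L2_norm_const)
    moreover obtain C where "\<And>u. u \<in> H1T \<Longrightarrow> cmod (w u) \<le> C * H1_norm u"
      using dual_on_bound[OF w] by blast
    ultimately have "cmod (w ?d) \<le> 0" using d by fastforce
    then show ?thesis by simp
  qed
  ultimately show ?thesis by simp
qed

text \<open>The integrand has mean zero, so the integral from x to 1 is minus the integral from 0 to
  x.\<close>

lemma J_op_eq:
  assumes \<phi>: "\<phi> \<in> L2" and x: "0 < x" "x < 1"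
  shows "J_op \<phi> x = - prim (\<lambda>y. \<phi> y - (LINT z|leb01. \<phi> z)) x"
proof -
  let ?\<psi> = "\<lambda>y. \<phi> y - (LINT z|leb01. \<phi> z)"
  have i: "integrable leb01 ?\<psi>" using L2_integrable[OF \<phi>] by simp
  have "J_op \<phi> x = (LINT y|leb01. (if y \<in> {x<..<1} then ?\<psi> y else 0))"
    unfolding J_op_def by (rule Lebesgue_Measure.integral_restrict[symmetric]) (use x in auto)
  also have "\<dots> = (LINT y|leb01. ?\<psi> y - (if y < x then ?\<psi> y else 0))"
  proof (rule integral_cong_AE)
    show m: "(\<lambda>y. ?\<psi> y - (if y < x then ?\<psi> y else 0)) \<in> borel_measurable leb01"
      using i by (intro borel_measurable_diff borel_measurable_integrable integrable_if_less)
    show ae: "AE y in leb01. (if y \<in> {x<..<1} then ?\<psi> y else 0) = ?\<psi> y - (if y < x then ?\<psi> y else 0)"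
      using AE_leb01_neq[of x] AE_space by eventually_elim auto
    have "{x<..<1} \<inter> space leb01 \<in> sets leb01"
      using x by (subst sets_restrict_space) (auto intro!: image_eqI[of _ _ "{x<..<1}"])
    then show "(\<lambda>y. if y \<in> {x<..<1} then ?\<psi> y else 0) \<in> borel_measurable leb01"
      by (rule measurable_If_set[OF borel_measurable_integrable[OF i] borel_measurable_const])
  qed
  also have "\<dots> = (LINT y|leb01. ?\<psi> y) - prim ?\<psi> x"
    unfolding prim_def by (rule Bochner_Integration.integral_diff[OF i integrable_if_less[OF i]])
  also have "(LINT y|leb01. ?\<psi> y) = 0"
    using L2_integrable[OF \<phi>] by (subst Bochner_Integration.integral_diff) auto
  finally show ?thesis by simp
qed

text \<open>Having a mean-zero integrand, the primitive vanishes at 1 as well as at 0; this is why J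
  maps even into H^1_0.\<close>

lemma
  assumes \<phi>: "\<phi> \<in> L2"
  shows J_op_H10: "J_op \<phi> \<in> H10"
    and weak_deriv_J_op: "AE x in leb01. weak_deriv (J_op \<phi>) x = (LINT z|leb01. \<phi> z) - \<phi> x"
    and J_op_AE: "AE x in leb01. J_op \<phi> x = prim (\<lambda>y. (LINT z|leb01. \<phi> z) - \<phi> y) x"
proof -
  let ?g = "\<lambda>y. (LINT z|leb01. \<phi> z) - \<phi> y"
  have g: "?g \<in> L2" by (intro L2_intros \<phi>)
  have eq: "J_op \<phi> x = prim ?g x" if "0 < x" "x < 1" for x
    using J_op_eq[OF \<phi> that] prim_cmult[of "-1" ?g x] by simp
  then show ae: "AE x in leb01. J_op \<phi> x = prim ?g x" by (intro AE_I2) simp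
  then have ae0: "AE x in leb01. J_op \<phi> x = 0 + prim ?g x" by simp
  have "J_op \<phi> \<in> borel_measurable leb01 \<longleftrightarrow> prim ?g \<in> borel_measurable leb01"
    by (rule measurable_cong) (simp add: eq)
  then have "J_op \<phi> \<in> borel_measurable leb01"
    using L2_measurable[OF L2_prim[OF L2_integrable[OF g]]] by simp
  from L2_cong_AE[OF L2_prim[OF L2_integrable[OF g]] this ae]
  have J: "J_op \<phi> \<in> L2" .
  have "(LINT x|leb01. ?g x) = 0"
    using L2_integrable[OF \<phi>] by (subst Bochner_Integration.integral_diff) auto
  then show "J_op \<phi> \<in> H10"
    using H1I[OF J g ae0] crep_0_eq[OF J g ae0] crep_1_eq[OF J g ae0] by (simp add: H10_def)
  show "AE x in leb01. weak_deriv (J_op \<phi>) x = ?g x"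
    by (rule weak_deriv_eq[OF J g ae0])
qed

lemma J_op_H1T: "\<phi> \<in> L2 \<Longrightarrow> J_op \<phi> \<in> H1T"
  by (intro H10_imp_H1T J_op_H10)

text \<open>The primitive is bounded pointwise by the L^1 norm of g, and the interval has length
  1.\<close>

lemma L2_norm_prim_le:
  assumes g: "g \<in> L2"
  shows "L2_norm (prim g) \<le> L2_norm g"
proof -
  have "cmod (prim g x) \<le> L2_norm g" for x
  proof -
    have "cmod (prim g x) \<le> (LINT y|leb01. cmod (if y < x then g y else 0))"
      unfolding prim_def by (rule integral_norm_bound)
    also have "\<dots> \<le> (LINT y|leb01. cmod (g y))"
      by (intro integral_mono integrable_norm integrable_if_less L2_integrable g) auto
    also have "\<dots> \<le> L2_norm g" by (rule integral_norm_le_L2_norm[OF g])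
    finally show ?thesis .
  qed
  then have "(LINT x|leb01. (cmod (prim g x))\<^sup>2) \<le> (LINT x|leb01. (L2_norm g)\<^sup>2)"
    by (intro integral_mono L2_square_integrable L2_prim L2_integrable g) (auto intro: power_mono)
  then have "(L2_norm (prim g))\<^sup>2 \<le> (L2_norm g)\<^sup>2"
    by (simp only: L2_norm_square[of "prim g"] integral_leb01_const)
  then show ?thesis by (rule power2_le_imp_le) (rule L2_norm_nonneg)
qed

text \<open>Removing the mean m lowers the square of the L^2 norm by |m|^2; the factor 2 rounds up
  sqrt 2. This is the bound that makes \<open>w (J_op \<phi>)\<close> accessible to the Riesz
  theorem.\<close>

lemma H1_norm_J_op_le:
  assumes \<phi>: "\<phi> \<in> L2"
  shows "H1_norm (J_op \<phi>) \<le> 2 * L2_norm \<phi>"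
proof -
  let ?m = "LINT z|leb01. \<phi> z"
  let ?g = "\<lambda>y. ?m - \<phi> y"
  have g: "?g \<in> L2" by (intro L2_intros \<phi>)
  have J: "J_op \<phi> \<in> H1" by (intro H1T_imp_H1 J_op_H1T \<phi>)
  have "(LINT x|leb01. ?m * cnj (- 1 * \<phi> x)) = - (?m * cnj ?m)"
    by simp
  then have "(L2_norm ?g)\<^sup>2 = (cmod ?m)\<^sup>2 + (L2_norm \<phi>)\<^sup>2 - 2 * (cmod ?m)\<^sup>2"
    using L2_norm_add_square[OF L2_const L2_cmult[OF \<phi>], of ?m "-1"] L2_norm_cmult[of "-1" \<phi>]
    by (simp add: L2_norm_const flip: complex_norm_square)
  then have le: "(L2_norm ?g)\<^sup>2 \<le> (L2_norm \<phi>)\<^sup>2" by simp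
  have 1: "L2_norm (J_op \<phi>) = L2_norm (prim ?g)"
    by (intro L2_norm_cong_AE J_op_AE \<phi> L2_measurable H1_L2 J L2_prim L2_integrable g)
  have 2: "L2_norm (weak_deriv (J_op \<phi>)) = L2_norm ?g"
    by (intro L2_norm_cong_AE weak_deriv_J_op \<phi> L2_measurable weak_deriv_L2 J g)
  have "(L2_norm (prim ?g))\<^sup>2 \<le> (L2_norm ?g)\<^sup>2"
    by (intro power_mono L2_norm_prim_le g L2_norm_nonneg)
  then have "(H1_norm (J_op \<phi>))\<^sup>2 \<le> 2 * (L2_norm \<phi>)\<^sup>2"
    using le by (simp add: H1_norm_def 1 2)
  also have "\<dots> \<le> (2 * L2_norm \<phi>)\<^sup>2" by (simp add: power_mult_distrib)
  finally show ?thesis by (rule power2_le_imp_le) (simp add: L2_norm_nonneg)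
qed

text \<open>\<open>P_op u\<close> is a choice; testing against all of L^2 pins it down up to a null
  set.\<close>

lemma
  assumes p: "p \<in> L2" and pu: "\<And>\<phi>. \<phi> \<in> L2 \<Longrightarrow> (LINT x|leb01. p x * \<phi> x) = u (J_op \<phi>)"
  shows P_op_L2_if: "P_op u \<in> L2" and P_op_AE_eq: "AE x in leb01. P_op u x = p x"
proof -
  have P: "P_op u \<in> L2 \<and> (\<forall>\<phi>\<in>L2. (LINT x|leb01. P_op u x * \<phi> x) = u (J_op \<phi>))"
    unfolding P_op_def by (rule someI[of _ p]) (use p pu in auto)
  then show "P_op u \<in> L2" by simp
  show "AE x in leb01. P_op u x = p x"
    by (rule L2_eq_AE_if_tested) (use P p pu in auto)
qed

text \<open>The Riesz theorem applied to phi |-> w (J phi). Linearity of J is used only on the open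
  interval, so it passes through w by \<open>Hm1T_cong_AE\<close>.\<close>

lemma
  assumes w: "w \<in> Hm1T"
  shows P_op_L2: "P_op w \<in> L2"
    and P_op_tested: "\<phi> \<in> L2 \<Longrightarrow> (LINT x|leb01. P_op w x * \<phi> x) = w (J_op \<phi>)"
proof -
  obtain C where C: "C \<ge> 0" "\<And>u. u \<in> H1T \<Longrightarrow> cmod (w u) \<le> C * H1_norm u"
    using dual_on_bound[OF w] by blast
  obtain p where p: "p \<in> L2" "\<And>\<phi>. \<phi> \<in> L2 \<Longrightarrow> (LINT x|leb01. p x * \<phi> x) = w (J_op \<phi>)"
  proof (rule L2_Riesz[of "\<lambda>\<phi>. w (J_op \<phi>)" "C * 2"])
    fix f g assume f: "f \<in> L2" and g: "g \<in> L2"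
    have "AE x in leb01. J_op (\<lambda>x. f x + g x) x = J_op f x + J_op g x"
    proof (rule AE_I2)
      fix x assume "x \<in> space leb01"
      then have x: "0 < x" "x < 1" by auto
      note i = f[THEN L2_integrable] g[THEN L2_integrable]
      have "prim (\<lambda>y. f y + g y - (LINT z|leb01. f z + g z)) x =
         prim (\<lambda>y. (f y - (LINT z|leb01. f z)) + (g y - (LINT z|leb01. g z))) x"
        using i by (simp add: algebra_simps)
      also have "\<dots> = prim (\<lambda>y. f y - (LINT z|leb01. f z)) x + prim (\<lambda>y. g y - (LINT z|leb01. g z)) x"
        using i by (intro prim_add) auto
      finally show "J_op (\<lambda>x. f x + g x) x = J_op f x + J_op g x"
        by (simp add: J_op_eq[OF f x] J_op_eq[OF g x] J_op_eq[OF L2_add[OF f g] x])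
    qed
    then have "w (J_op (\<lambda>x. f x + g x)) = w (\<lambda>x. J_op f x + J_op g x)"
      by (intro Hm1T_cong_AE[OF w] H1T_add J_op_H1T L2_add f g)
    then show "w (J_op (\<lambda>x. f x + g x)) = w (J_op f) + w (J_op g)"
      by (simp add: dual_on_add[OF w] J_op_H1T f g)
  next
    fix c f assume f: "f \<in> L2"
    have "AE x in leb01. J_op (\<lambda>x. c * f x) x = c * J_op f x"
    proof (rule AE_I2)
      fix x assume "x \<in> space leb01"
      then have x: "0 < x" "x < 1" by auto
      have "prim (\<lambda>y. c * f y - (LINT z|leb01. c * f z)) x = prim (\<lambda>y. c * (f y - (LINT z|leb01. f z))) x"
        by (simp add: algebra_simps)
      then show "J_op (\<lambda>x. c * f x) x = c * J_op f x"
        by (simp add: J_op_eq[OF f x] J_op_eq[OF L2_cmult[OF f] x] prim_cmult)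
    qed
    then have "w (J_op (\<lambda>x. c * f x)) = w (\<lambda>x. c * J_op f x)"
      by (intro Hm1T_cong_AE[OF w] H1T_cmult J_op_H1T L2_cmult f)
    then show "w (J_op (\<lambda>x. c * f x)) = c * w (J_op f)"
      by (simp add: dual_on_cmult[OF w] J_op_H1T f)
  next
    fix f assume f: "f \<in> L2"
    have "cmod (w (J_op f)) \<le> C * H1_norm (J_op f)" by (intro C J_op_H1T f)
    also have "\<dots> \<le> C * (2 * L2_norm f)" by (intro mult_left_mono H1_norm_J_op_le f C)
    finally show "cmod (w (J_op f)) \<le> C * 2 * L2_norm f" by simp
  qed blast
  show "P_op w \<in> L2" by (rule P_op_L2_if[where u = w, OF p])
  have ae: "AE x in leb01. P_op w x = p x" by (rule P_op_AE_eq[where u = w, OF p])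
  assume \<phi>: "\<phi> \<in> L2"
  have "(LINT x|leb01. P_op w x * \<phi> x) = (LINT x|leb01. p x * \<phi> x)"
    by (intro integral_cong_AE borel_measurable_times L2_measurable \<phi> p \<open>P_op w \<in> L2\<close>)
      (use ae in \<open>eventually_elim, simp\<close>)
  then show "(LINT x|leb01. P_op w x * \<phi> x) = w (J_op \<phi>)" using p(2)[OF \<phi>] by simp
qed

text \<open>
  Every $v \in H^1(T)$ is $J(-v') + v(1)$, so a functional is determined by its image under $P$
  together with its value on the constants.
\<close>

lemma Hm1T_apply:
  assumes w: "w \<in> Hm1T" and v: "v \<in> H1T"
  shows "w v = - (LINT x|leb01. P_op w x * weak_deriv v x) + crep v 1 * mu0 w"
proof -
  have v1: "v \<in> H1" by (rule H1T_imp_H1[OF v])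
  let ?\<phi> = "\<lambda>x. - weak_deriv v x"
  have \<phi>: "?\<phi> \<in> L2" by (intro L2_minus weak_deriv_L2 v1)
  have mean: "(LINT x|leb01. ?\<phi> x) = 0"
    using crep_1[OF v1] v by (simp add: H1T_def)
  have c: "crep v 0 = crep v 1" using v by (simp add: H1T_def)
  have "AE x in leb01. v x = J_op ?\<phi> x + crep v 1 * 1"
    using J_op_AE[OF \<phi>] H1_rep[OF v1] unfolding mean by eventually_elim (simp add: c)
  then have "w v = w (\<lambda>x. J_op ?\<phi> x + crep v 1 * 1)"
    by (intro Hm1T_cong_AE[OF w] v H1T_add H1T_cmult H1T_const J_op_H1T \<phi>)
  also have "\<dots> = w (J_op ?\<phi>) + w (\<lambda>x. crep v 1 * 1)"
    by (intro dual_on_add[OF w] J_op_H1T \<phi> H1T_const)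
  also have "w (\<lambda>x. crep v 1 * 1) = crep v 1 * mu0 w"
    unfolding mu0_def by (rule dual_on_cmult[OF w H1T_const])
  also have "w (J_op ?\<phi>) = - (LINT x|leb01. P_op w x * weak_deriv v x)"
    using P_op_tested[OF w \<phi>] by simp
  finally show ?thesis .
qed

lemma Hm1T_eqI:
  assumes w: "w \<in> Hm1T" "w' \<in> Hm1T" and P: "AE x in leb01. P_op w x = P_op w' x"
    and m: "mu0 w = mu0 w'"
  shows "w = w'"
proof
  fix v
  show "w v = w' v"
  proof (cases "v \<in> H1T")
    case True
    note wd = weak_deriv_L2[OF H1T_imp_H1[OF True]]
    have "(LINT x|leb01. P_op w x * weak_deriv v x) = (LINT x|leb01. P_op w' x * weak_deriv v x)"
      by (intro integral_cong_AE borel_measurable_times L2_measurable P_op_L2 w wd)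
        (use P in \<open>eventually_elim, simp\<close>)
    then show ?thesis using Hm1T_apply[OF w(1) True] Hm1T_apply[OF w(2) True] m by simp
  qed (simp add: dual_on_outside[OF w(1)] dual_on_outside[OF w(2)])
qed

text \<open>J annihilates constants, since it removes the mean first.\<close>

lemma integral_P_op:
  assumes w: "w \<in> Hm1T"
  shows "(LINT x|leb01. P_op w x) = 0"
proof -
  have "AE x in leb01. J_op (\<lambda>_. 1) x = 0 * 1"
    using J_op_AE[OF L2_const[of 1]] by eventually_elim (simp add: prim_def)
  then have "w (J_op (\<lambda>_. 1)) = w (\<lambda>_. 0 * 1)"
    by (intro Hm1T_cong_AE[OF w] J_op_H1T L2_const H1T_const)
  also have "\<dots> = 0 * w (\<lambda>_. 1)" by (rule dual_on_cmult[OF w H1T_const])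
  finally show ?thesis using P_op_tested[OF w L2_const[of 1]] by simp
qed

lemma mu0_emb: "mu0 (emb h) = (LINT x|leb01. h x)"
  by (simp add: mu0_def emb_def H1T_const)

text \<open>Integration by parts against the constant 1, whose primitive is x; this is the origin of
  the weight 1 - x in \<open>mu1\<close>.\<close>

lemma integral_prim_eq_mu1:
  assumes h: "integrable leb01 h"
  shows "(LINT x|leb01. prim h x) = mu1 h"
proof -
  have i: "integrable leb01 (\<lambda>x. h x * of_real x)"
  proof (rule Bochner_Integration.integrable_bound[OF h])
    show "(\<lambda>x. h x * of_real x) \<in> borel_measurable leb01"
      by (rule borel_measurable_times[OF borel_measurable_integrable[OF h] measurable_leb01_continuous])
        (intro continuous_intros)
  qed (auto simp: norm_mult mult_left_le)
  have "(LINT x|leb01. h x * prim (\<lambda>_. 1) x) = (LINT x|leb01. h x * of_real x)"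
    by (rule Bochner_Integration.integral_cong) (auto simp: prim_const)
  then have "(LINT x|leb01. prim h x) = (LINT x|leb01. h x) - (LINT x|leb01. h x * of_real x)"
    using integral_prim_by_parts[OF h, of "\<lambda>_. 1"] by (simp add: eq_diff_eq add.commute)
  also have "\<dots> = mu1 h"
    unfolding mu1_def by (subst Bochner_Integration.integral_diff[symmetric, OF h i])
      (auto intro!: Bochner_Integration.integral_cong simp: algebra_simps)
  finally show ?thesis .
qed

text \<open>J phi is the primitive of a mean-zero function, so integration by parts has no boundary
  product; the mean removed from phi reappears as the constant \<open>mu1 h\<close>, the mean of
  \<open>prim h\<close>.\<close>

lemma
  assumes h: "h \<in> L2"
  shows P_op_emb_L2: "P_op (emb h) \<in> L2"
    and P_op_emb: "AE x in leb01. P_op (emb h) x = prim h x - mu1 h"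
proof -
  note i = L2_integrable[OF h]
  have p: "(\<lambda>x. prim h x - mu1 h) \<in> L2" by (intro L2_intros L2_prim i)
  have test: "(LINT x|leb01. (prim h x - mu1 h) * \<phi> x) = emb h (J_op \<phi>)" if \<phi>: "\<phi> \<in> L2" for \<phi>
  proof -
    let ?m = "LINT z|leb01. \<phi> z"
    let ?g = "\<lambda>y. ?m - \<phi> y"
    have g: "?g \<in> L2" by (intro L2_intros \<phi>)
    have g0: "(LINT x|leb01. ?g x) = 0"
      using L2_integrable[OF \<phi>] by (subst Bochner_Integration.integral_diff) auto
    have "emb h (J_op \<phi>) = (LINT x|leb01. h x * J_op \<phi> x)"
      by (simp add: emb_def J_op_H1T \<phi>)
    also have "\<dots> = (LINT x|leb01. h x * prim ?g x)"
      by (intro integral_cong_AE borel_measurable_times L2_measurable h H1_L2[OF H1T_imp_H1[OF J_op_H1T[OF \<phi>]]] L2_prim L2_integrable g)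
        (use J_op_AE[OF \<phi>] in \<open>eventually_elim, simp\<close>)
    also have "\<dots> = - (LINT x|leb01. prim h x * ?g x)"
      using integral_prim_by_parts[OF i L2_integrable[OF g]] unfolding g0 by (simp add: add_eq_0_iff2)
    also have "\<dots> = (LINT x|leb01. prim h x * \<phi> x - prim h x * ?m)"
      by (subst Bochner_Integration.integral_minus[symmetric]) (simp add: algebra_simps)
    also have "\<dots> = (LINT x|leb01. prim h x * \<phi> x) - (LINT x|leb01. prim h x) * ?m"
      using L2_mult_integrable[OF L2_prim[OF i] \<phi>] L2_integrable[OF L2_prim[OF i]] by simp
    also have "\<dots> = (LINT x|leb01. prim h x * \<phi> x - mu1 h * \<phi> x)"
      using L2_mult_integrable[OF L2_prim[OF i] \<phi>] L2_integrable[OF \<phi>]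
      by (simp add: integral_prim_eq_mu1[OF i])
    finally show ?thesis by (simp add: algebra_simps)
  qed
  show "P_op (emb h) \<in> L2" "AE x in leb01. P_op (emb h) x = prim h x - mu1 h"
    by (rule P_op_L2_if[where u = "emb h", OF p test] P_op_AE_eq[where u = "emb h", OF p test]; assumption)+
qed

section \<open>The functionals occurring in the description of the operator\<close>

text \<open>The formula of \<open>second_deriv\<close> on the larger space H^1(T). As v and v - v(1)
  have the same derivative, this is Id_m^{-1}(f'').\<close>

definition dirichlet :: "(real \<Rightarrow> complex) \<Rightarrow> (real \<Rightarrow> complex) \<Rightarrow> complex" where
  "dirichlet f v = (if v \<in> H1T then - (LINT x|leb01. weak_deriv f x * weak_deriv v x) else 0)"

lemma integral_mult_right_cong_AE:
  assumes g: "g \<in> L2" and u: "u \<in> L2" and v: "v \<in> L2" and ae: "AE x in leb01. u x = v x"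
  shows "(LINT x|leb01. g x * u x) = (LINT x|leb01. g x * v x)"
  by (intro integral_cong_AE borel_measurable_times L2_measurable g u v)
    (use ae in \<open>eventually_elim, simp\<close>)

text \<open>Continuity is Cauchy-Schwarz; constants have zero weak derivative, whence
  \<open>mu0\<close> vanishes.\<close>

lemma dirichlet_Hzero:
  assumes f: "f \<in> H1"
  shows "dirichlet f \<in> Hzero"
proof -
  note g = weak_deriv_L2[OF f]
  have "dirichlet f (\<lambda>x. u x + v x) = dirichlet f u + dirichlet f v" if u: "u \<in> H1T" and v: "v \<in> H1T" for u v
  proof -
    note uv = weak_deriv_L2[OF H1T_imp_H1[OF u]] weak_deriv_L2[OF H1T_imp_H1[OF v]]
    have "(LINT x|leb01. weak_deriv f x * weak_deriv (\<lambda>x. u x + v x) x) =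
        (LINT x|leb01. weak_deriv f x * (weak_deriv u x + weak_deriv v x))"
      by (intro integral_mult_right_cong_AE g weak_deriv_L2 weak_deriv_add H1_add L2_add H1T_imp_H1 u v)
    then show ?thesis
      using L2_mult_integrable[OF g uv(1)] L2_mult_integrable[OF g uv(2)]
      by (simp add: dirichlet_def u v H1T_add distrib_left)
  qed
  moreover have "dirichlet f (\<lambda>x. c * u x) = c * dirichlet f u" if u: "u \<in> H1T" for c u
  proof -
    have "(LINT x|leb01. weak_deriv f x * weak_deriv (\<lambda>x. c * u x) x) =
        (LINT x|leb01. weak_deriv f x * (c * weak_deriv u x))"
      by (intro integral_mult_right_cong_AE g weak_deriv_L2 weak_deriv_cmult H1_cmult L2_cmult H1T_imp_H1 u)
    also have "\<dots> = c * (LINT x|leb01. weak_deriv f x * weak_deriv u x)"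
      by (subst integral_mult_right_zero[symmetric]) (simp only: mult.left_commute)
    finally show ?thesis by (simp add: dirichlet_def u H1T_cmult)
  qed
  moreover have "cmod (dirichlet f u) \<le> L2_norm (weak_deriv f) * H1_norm u" if u: "u \<in> H1T" for u
  proof -
    have "cmod (dirichlet f u) \<le> L2_norm (weak_deriv f) * L2_norm (weak_deriv u)"
      using L2_Cauchy_Schwarz[OF g weak_deriv_L2[OF H1T_imp_H1[OF u]]] by (simp add: dirichlet_def u)
    also have "\<dots> \<le> L2_norm (weak_deriv f) * H1_norm u"
      by (intro mult_left_mono L2_norm_weak_deriv_le_H1_norm L2_norm_nonneg)
    finally show ?thesis .
  qed
  then have "\<exists>C. \<forall>u\<in>H1T. cmod (dirichlet f u) \<le> C * H1_norm u" by blast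
  moreover have "dirichlet f u = 0" if "u \<notin> H1T" for u using that by (simp add: dirichlet_def)
  ultimately have "dirichlet f \<in> Hm1T"
    unfolding dual_on_def by blast
  moreover have "mu0 (dirichlet f) = 0"
  proof -
    have "(LINT x|leb01. weak_deriv f x * weak_deriv (\<lambda>_. 1) x) = (LINT x|leb01. weak_deriv f x * 0)"
      by (intro integral_mult_right_cong_AE g weak_deriv_L2 H1_const L2_const weak_deriv_const)
    then show ?thesis by (simp add: mu0_def dirichlet_def H1T_const)
  qed
  ultimately show ?thesis by (simp add: Hzero_def)
qed

text \<open>J takes values in H^1_0, so the restriction already determines Pw, while
  \<open>mu0 w\<close> is 0 in \<open>Hzero\<close>.\<close>

lemma inj_on_Id_m: "inj_on Id_m Hzero"
proof (rule inj_onI)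
  fix w w' assume w: "w \<in> Hzero" "w' \<in> Hzero" and eq: "Id_m w = Id_m w'"
  then have w': "w \<in> Hm1T" "w' \<in> Hm1T" "mu0 w = mu0 w'" by (auto simp: Hzero_def)
  have "w (J_op \<phi>) = w' (J_op \<phi>)" if "\<phi> \<in> L2" for \<phi>
    using fun_cong[OF eq, of "J_op \<phi>"] J_op_H10[OF that] by (simp add: Id_m_def)
  then show "w = w'"
    by (intro Hm1T_eqI L2_eq_AE_if_tested P_op_L2 w') (simp add: P_op_tested w')
qed

lemma Id_m_inv_second_deriv:
  assumes f: "f \<in> H1"
  shows "Id_m_inv (second_deriv f) = dirichlet f"
  unfolding Id_m_inv_def
proof (rule the_inv_into_f_eq[OF inj_on_Id_m _ dirichlet_Hzero[OF f]])
  show "Id_m (dirichlet f) = second_deriv f"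
    by (auto simp: Id_m_def second_deriv_def dirichlet_def H10_imp_H1T)
qed

text \<open>Trace estimate: integrating the derivative of x v(x) writes v(1) as the integral of v
  plus that of x v', each at most the H^1 norm; hence the constant 2.\<close>

lemma delta1_Hm1T: "delta1 \<in> Hm1T"
proof -
  have "AE x in leb01. of_real x = 0 + prim (\<lambda>_. 1) x"
    by (rule AE_I2) (auto simp: prim_const)
  note x = L2_continuous[OF continuous_on_of_real[OF continuous_on_id]] L2_const[of 1] this
  have x1: "(of_real :: real \<Rightarrow> complex) \<in> H1" and wd: "AE x in leb01. weak_deriv of_real x = 1"
    and c: "crep of_real 0 = 0" "crep of_real 1 = 1"
    using H1I[OF x] weak_deriv_eq[OF x] crep_0_eq[OF x] crep_1_eq[OF x] by auto
  have "cmod (crep v 1) \<le> 2 * H1_norm v" if v: "v \<in> H1" for v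
  proof -
    have "(LINT x|leb01. v x * 1) = (LINT x|leb01. v x * weak_deriv of_real x)"
      by (intro integral_mult_right_cong_AE H1_L2 v L2_const weak_deriv_L2 x1) (use wd in auto)
    then have v1: "crep v 1 = (LINT x|leb01. v x) + (LINT x|leb01. of_real x * weak_deriv v x)"
      using H1_by_parts[OF x1 v] by (simp add: c mult.commute)
    have "cmod (LINT x|leb01. v x) \<le> L2_norm v"
      using integral_norm_bound[of leb01 v] integral_norm_le_L2_norm[OF H1_L2[OF v]] by linarith
    moreover have "cmod (LINT x|leb01. of_real x * weak_deriv v x) \<le> L2_norm (weak_deriv v)"
    proof -
      have "cmod (LINT x|leb01. of_real x * weak_deriv v x) \<le> (LINT x|leb01. cmod (weak_deriv v x))"
        by (intro Bochner_Integration.integral_norm_bound_integral L2_mult_integrable H1_L2 x1 weak_deriv_L2 v integrable_norm L2_integrable)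
          (auto simp: norm_mult intro!: mult_left_le_one_le)
      then show ?thesis using integral_norm_le_L2_norm[OF weak_deriv_L2[OF v]] by linarith
    qed
    ultimately show ?thesis
      unfolding v1
      using norm_triangle_ineq[of "LINT x|leb01. v x" "LINT x|leb01. of_real x * weak_deriv v x"]
        L2_norm_le_H1_norm[of v] L2_norm_weak_deriv_le_H1_norm[of v] by linarith
  qed
  then have "\<exists>C. \<forall>u\<in>H1T. cmod (delta1 u) \<le> C * H1_norm u"
    by (intro exI[of _ 2]) (simp add: delta1_def H1T_imp_H1)
  then show ?thesis
    unfolding dual_on_def
    by (auto simp: delta1_def H1T_add H1T_cmult crep_add_1 crep_cmult_1 H1T_imp_H1)
qed

text \<open>\<open>dirichlet f\<close> kills constants and \<open>delta1\<close> is 1 at the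
  constant 1, so c can be recovered from the functional.\<close>

lemma candidate_Hm1T:
  assumes f: "f \<in> H1"
  shows "(\<lambda>v. - dirichlet f v - c * delta1 v) \<in> Hm1T"
    and "mu0 (\<lambda>v. - dirichlet f v - c * delta1 v) = - c"
proof -
  have "(\<lambda>v. - 1 * dirichlet f v + - c * delta1 v) \<in> Hm1T"
    using dirichlet_Hzero[OF f] by (intro dual_on_lincomb delta1_Hm1T) (simp add: Hzero_def)
  then show "(\<lambda>v. - dirichlet f v - c * delta1 v) \<in> Hm1T" by simp
  show "mu0 (\<lambda>v. - dirichlet f v - c * delta1 v) = - c"
    using dirichlet_Hzero[OF f] by (simp add: Hzero_def mu0_def delta1_def H1T_const crep_const_1)
qed

text \<open>An equation for Pw fixes w up to a multiple of \<open>delta1\<close>, and that multiple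
  is \<open>mu0 w\<close>. The mean of f' appears because Pw has mean zero; it drops out in testing
  because derivatives of functions in H^1(T) have mean zero.\<close>

lemma P_op_eq_iff:
  assumes f: "f \<in> H1" and w: "w \<in> Hm1T"
  shows "(AE x in leb01. P_op w x = (LINT y|leb01. weak_deriv f y) - weak_deriv f x) \<longleftrightarrow>
    w = (\<lambda>v. - dirichlet f v - (- mu0 w) * delta1 v)" (is "?P \<longleftrightarrow> ?w")
proof
  note g = weak_deriv_L2[OF f]
  let ?m = "LINT y|leb01. weak_deriv f y"
  have gm: "(\<lambda>x. ?m - weak_deriv f x) \<in> L2" by (intro L2_intros g)
  assume P: ?P
  show ?w
  proof
    fix v
    show "w v = - dirichlet f v - (- mu0 w) * delta1 v"
    proof (cases "v \<in> H1T")
      case True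
      note v = weak_deriv_L2[OF H1T_imp_H1[OF True]]
      have v0: "(LINT x|leb01. weak_deriv v x) = 0"
        using crep_1[OF H1T_imp_H1[OF True]] True by (simp add: H1T_def)
      have "(LINT x|leb01. P_op w x * weak_deriv v x) = (LINT x|leb01. (?m - weak_deriv f x) * weak_deriv v x)"
        by (intro integral_cong_AE borel_measurable_times L2_measurable P_op_L2 w gm v)
          (use P in \<open>eventually_elim, simp\<close>)
      also have "\<dots> = ?m * (LINT x|leb01. weak_deriv v x) - (LINT x|leb01. weak_deriv f x * weak_deriv v x)"
        using L2_integrable[OF v] L2_mult_integrable[OF g v] by (simp add: left_diff_distrib)
      finally show ?thesis
        using Hm1T_apply[OF w True] True by (simp add: v0 dirichlet_def delta1_def)
    qed (simp add: dual_on_outside[OF w] dirichlet_def delta1_def)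
  qed
next
  note g = weak_deriv_L2[OF f]
  let ?m = "LINT y|leb01. weak_deriv f y"
  have gm: "(\<lambda>x. ?m - weak_deriv f x) \<in> L2" by (intro L2_intros g)
  assume eq: ?w
  show ?P
  proof (rule P_op_AE_eq[where u = w, OF gm])
    fix \<phi> assume \<phi>: "\<phi> \<in> L2"
    let ?n = "LINT y|leb01. \<phi> y"
    \<comment> \<open>The \<open>delta1\<close> term vanishes because J phi lies in H^1_0.\<close>
    have "w (J_op \<phi>) = (LINT x|leb01. weak_deriv f x * weak_deriv (J_op \<phi>) x)"
      using J_op_H10[OF \<phi>] by (subst eq) (simp add: dirichlet_def delta1_def J_op_H1T \<phi> H10_def)
    also have "\<dots> = (LINT x|leb01. weak_deriv f x * (?n - \<phi> x))"
      by (intro integral_mult_right_cong_AE g weak_deriv_L2 H1T_imp_H1 J_op_H1T \<phi> weak_deriv_J_op L2_intros)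
    also have "\<dots> = ?m * ?n - (LINT x|leb01. weak_deriv f x * \<phi> x)"
      using L2_integrable[OF g] L2_mult_integrable[OF g \<phi>] by (simp add: right_diff_distrib)
    also have "\<dots> = (LINT x|leb01. (?m - weak_deriv f x) * \<phi> x)"
      using L2_integrable[OF \<phi>] L2_mult_integrable[OF g \<phi>] by (simp add: left_diff_distrib)
    finally show "(LINT x|leb01. (?m - weak_deriv f x) * \<phi> x) = w (J_op \<phi>)" ..
  qed
qed

section \<open>The form and its associated operator\<close>

lemma C2_inner_eq: "C2_inner x y = x $ 1 * cnj (y $ 1) + x $ 2 * cnj (y $ 2)"
  by (simp add: C2_inner_def UNIV_2)

lemma C2_inner_add: "C2_inner (x + y) z = C2_inner x z + C2_inner y z"
  by (simp add: C2_inner_eq algebra_simps)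

lemma Gamma1_components: "Gamma1 f $ 1 = (LINT x|leb01. f x)" "Gamma1 f $ 2 = mu1 f"
  by (simp_all add: Gamma1_def mu0_emb)

lemma L2_affine: "(\<lambda>x. a + b * of_real (1 - x)) \<in> L2"
  by (intro L2_continuous continuous_intros)

lemma integral_affine:
  "(LINT x|leb01. a + b * of_real (1 - x)) = a + b / 2"
  "mu1 (\<lambda>x. a + b * of_real (1 - x)) = a / 2 + b / 3"
proof -
  have int: "(LINT x|leb01. a * of_real (p x) + b * of_real (q x)) =
      a * of_real (P 1 - P 0) + b * of_real (Q 1 - Q 0)"
    if "\<And>x. (P has_real_derivative p x) (at x)" "\<And>x. (Q has_real_derivative q x) (at x)"
      "continuous_on UNIV p" "continuous_on UNIV q" for p q P Q :: "real \<Rightarrow> real"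
  proof -
    let ?F = "\<lambda>x. a * of_real (P x) + b * of_real (Q x)"
    let ?f = "\<lambda>x. a * of_real (p x) + b * of_real (q x)"
    have "(?F has_vector_derivative ?f x) (at x)" for x
      by (intro has_vector_derivative_add has_vector_derivative_mult_right has_vector_derivative_of_real)
        (use that in \<open>auto simp: has_real_derivative_iff_has_vector_derivative\<close>)
    moreover have "continuous_on UNIV ?f" by (intro continuous_intros that)
    ultimately have "prim ?f 1 = ?F 1 - ?F 0" by (intro prim_FTC) auto
    then show ?thesis by (simp add: prim_ge_1 algebra_simps)
  qed
  have "(LINT x|leb01. a * of_real 1 + b * of_real (1 - x)) =
      a * of_real (1 - 0) + b * of_real ((1 - 1\<^sup>2 / 2) - (0 - 0\<^sup>2 / 2))"
    by (rule int[of "\<lambda>x. x" _ "\<lambda>x. x - x\<^sup>2 / 2"])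
      (auto intro!: derivative_eq_intros continuous_intros)
  then show "(LINT x|leb01. a + b * of_real (1 - x)) = a + b / 2" by simp
  have "mu1 (\<lambda>x. a + b * of_real (1 - x)) = (LINT x|leb01. a * of_real (1 - x) + b * of_real ((1 - x)\<^sup>2))"
    unfolding mu1_def by (intro Bochner_Integration.integral_cong) (auto simp: power2_eq_square algebra_simps)
  also have "\<dots> = a * of_real ((1 - 1\<^sup>2 / 2) - (0 - 0\<^sup>2 / 2)) + b * of_real (- ((1 - 1) ^ 3) / 3 - (- ((1 - 0) ^ 3) / 3))"
    by (rule int[of "\<lambda>x. x - x\<^sup>2 / 2" _ "\<lambda>x. - ((1 - x) ^ 3) / 3"])
      (auto intro!: derivative_eq_intros continuous_intros simp: power2_eq_square)
  finally show "mu1 (\<lambda>x. a + b * of_real (1 - x)) = a / 2 + b / 3" by simp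
qed

text \<open>The Gram matrix of 1 and 1 - x has rows (1, 1/2) and (1/2, 1/3); the coefficients come
  from its inverse, with rows (4, -6) and (-6, 12).\<close>

lemma Gamma1_affine_surj:
  obtains a b where "Gamma1 (\<lambda>x. a + b * of_real (1 - x)) = y"
proof
  have "(4 * y $ 1 - 6 * y $ 2) + (12 * y $ 2 - 6 * y $ 1) / 2 = y $ 1"
    "(4 * y $ 1 - 6 * y $ 2) / 2 + (12 * y $ 2 - 6 * y $ 1) / 3 = y $ 2"
    by (simp_all add: field_simps)
  then show "Gamma1 (\<lambda>x. (4 * y $ 1 - 6 * y $ 2) + (12 * y $ 2 - 6 * y $ 1) * of_real (1 - x)) = y"
    by (simp only: vec_eq_iff forall_2 Gamma1_components integral_affine)
qed

lemma mu1_diff: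
  assumes "f \<in> L2" "g \<in> L2"
  shows "mu1 (\<lambda>x. f x - g x) = mu1 f - mu1 g"
proof -
  have "(\<lambda>x. of_real (1 - x)) \<in> L2" using L2_affine[of 0 1] by simp
  from this[THEN L2_mult_integrable, OF assms(1)] this[THEN L2_mult_integrable, OF assms(2)]
  show ?thesis unfolding mu1_def right_diff_distrib by (rule Bochner_Integration.integral_diff)
qed

text \<open>Says that the adjoint of \<open>Gamma1\<close> sends (a, b) to the affine function a +
  b(1 - x).\<close>

lemma L2_inner_affine:
  assumes h: "h \<in> L2"
  shows "L2_inner (\<lambda>x. a + b * of_real (1 - x)) h = C2_inner (vector [a, b]) (Gamma1 h)"
proof -
  note ch = L2_cnj[OF h]
  have x: "(\<lambda>x. of_real (1 - x)) \<in> L2" using L2_affine[of 0 1] by simp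
  have "L2_inner (\<lambda>x. a + b * of_real (1 - x)) h =
      (LINT x|leb01. a * cnj (h x) + b * (of_real (1 - x) * cnj (h x)))"
    unfolding L2_inner_def by (simp add: algebra_simps)
  also have "\<dots> = a * (LINT x|leb01. cnj (h x)) + b * (LINT x|leb01. of_real (1 - x) * cnj (h x))"
    using L2_integrable[OF ch] L2_mult_integrable[OF x ch] by (simp del: of_real_diff Bochner_Integration.integral_cnj)
  also have "(LINT x|leb01. of_real (1 - x) * cnj (h x)) = cnj (mu1 h)"
    unfolding mu1_def Bochner_Integration.integral_cnj[symmetric] by simp
  finally show ?thesis by (simp add: C2_inner_eq Gamma1_components)
qed

lemma L2_inner_diff_left:
  assumes "f \<in> L2" "g \<in> L2" "h \<in> L2"
  shows "L2_inner (\<lambda>x. f x - g x) h = L2_inner f h - L2_inner g h"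
  unfolding L2_inner_def left_diff_distrib
  by (intro Bochner_Integration.integral_diff L2_mult_integrable L2_cnj assms)

lemma L2_inner_cong_AE:
  assumes "f \<in> L2" "f' \<in> L2" "AE x in leb01. f x = f' x" "h \<in> L2"
  shows "L2_inner f h = L2_inner f' h"
  unfolding L2_inner_def
  by (intro integral_cong_AE borel_measurable_times L2_measurable L2_cnj assms)
    (use assms(3) in \<open>eventually_elim, simp\<close>)

text \<open>The boundary product and the term with \<open>mu1 h\<close> both carry the mean of Pw as
  a factor, which is zero.\<close>

lemma L2_inner_P_op_emb:
  assumes w: "w \<in> Hm1T" and h: "h \<in> L2"
  shows "L2_inner (P_op w) (P_op (emb h)) = - L2_inner (prim (P_op w)) h"
proof -
  note p = P_op_L2[OF w] and i = L2_integrable[OF P_op_L2[OF w]]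
  note ch = L2_cnj[OF h] and ich = L2_integrable[OF L2_cnj[OF h]]
  have "L2_inner (P_op w) (P_op (emb h)) = (LINT x|leb01. P_op w x * (prim (\<lambda>x. cnj (h x)) x - cnj (mu1 h)))"
    unfolding L2_inner_def
    by (intro integral_mult_right_cong_AE p L2_intros P_op_emb_L2 h L2_prim ich)
      (use P_op_emb[OF h] in \<open>eventually_elim, simp add: prim_cnj\<close>)
  also have "\<dots> = (LINT x|leb01. P_op w x * prim (\<lambda>x. cnj (h x)) x) - (LINT x|leb01. P_op w x) * cnj (mu1 h)"
    using L2_mult_integrable[OF p L2_prim[OF ich]] i by (simp add: right_diff_distrib)
  also have "\<dots> = - L2_inner (prim (P_op w)) h"
    using integral_prim_by_parts[OF i ich] by (simp add: integral_P_op[OF w] L2_inner_def eq_neg_iff_add_eq_0)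
  finally show ?thesis .
qed

lemma form_eq_iff_affine:
  assumes f: "f \<in> L2" and w: "w \<in> Hm1T" and Y: "0 \<in> Y"
  shows "(\<forall>h\<in>V_Y Y. a_form K f h = Hm1T_inner w (emb h)) \<longleftrightarrow>
    (\<exists>a b. (AE x in leb01. f x = a + b * of_real (1 - x) - prim (P_op w) x) \<and>
       K *v Gamma1 f + vector [a - mu0 w, b] \<in> C2_perp Y)" (is "?L \<longleftrightarrow> ?R")
proof -
  let ?p = "prim (P_op w)"
  have p: "?p \<in> L2" by (intro L2_prim L2_integrable P_op_L2 w)
  \<comment> \<open>f plus the primitive of Pw, put as a difference so that the rules for
    differences apply.\<close>
  let ?r = "\<lambda>x. f x - (- 1 * ?p x)"
  have r: "?r \<in> L2" by (intro L2_diff L2_cmult f p)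
  have p': "(\<lambda>x. - 1 * ?p x) \<in> L2" by (intro L2_cmult p)
  have form: "a_form K f h = Hm1T_inner w (emb h) \<longleftrightarrow>
      L2_inner ?r h + C2_inner (K *v Gamma1 f + vector [- mu0 w, 0]) (Gamma1 h) = 0" if h: "h \<in> L2" for h
  proof -
    have "L2_inner (\<lambda>x. - 1 * ?p x) h = - L2_inner ?p h"
      unfolding L2_inner_def by (simp flip: integral_minus)
    then have "L2_inner ?r h = L2_inner f h + L2_inner ?p h"
      using L2_inner_diff_left[OF f p' h] by simp
    moreover have "C2_inner (vector [- mu0 w, 0]) (Gamma1 h) = - (mu0 w * cnj (mu0 (emb h)))"
      by (simp add: C2_inner_eq Gamma1_components mu0_emb)
    ultimately show ?thesis
      by (auto simp: a_form_def Hm1T_inner_def L2_inner_P_op_emb[OF w h] C2_inner_add algebra_simps add_eq_0_iff2)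
  qed
  show ?thesis
  proof
    assume L: ?L
    \<comment> \<open>r - l, with l this affine function, is the component of r in the kernel of
      \<open>Gamma1\<close>. It is admissible as 0 lies in Y, orthogonal to r by the form identity
      and to l by \<open>L2_inner_affine\<close>; so it is orthogonal to itself.\<close>
    obtain a b where ab: "Gamma1 (\<lambda>x. a + b * of_real (1 - x)) = Gamma1 ?r"
      by (rule Gamma1_affine_surj)
    let ?l = "\<lambda>x. a + b * of_real (1 - x)"
    let ?h = "\<lambda>x. ?r x - ?l x"
    have h: "?h \<in> L2" by (rule L2_diff[OF r L2_affine])
    have "(LINT x|leb01. ?h x) = (LINT x|leb01. ?r x) - (LINT x|leb01. ?l x)"
      by (rule Bochner_Integration.integral_diff[OF L2_integrable[OF r] L2_integrable[OF L2_affine]])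
    also have "\<dots> = 0"
      using arg_cong[OF ab, of "\<lambda>y. y $ 1"] by (simp only: Gamma1_components) simp
    finally have h1: "(LINT x|leb01. ?h x) = 0" .
    have "mu1 ?h = 0"
      using arg_cong[OF ab, of "\<lambda>y. y $ 2"] mu1_diff[OF r L2_affine[of a b]] by (simp only: Gamma1_components) simp
    with h1 have G0: "Gamma1 ?h = 0" by (simp only: vec_eq_iff forall_2 Gamma1_components zero_index)
    then have "?h \<in> V_Y Y" using h Y by (simp add: V_Y_def)
    then have "L2_inner ?r ?h + C2_inner (K *v Gamma1 f + vector [- mu0 w, 0]) (Gamma1 ?h) = 0"
      using L form[OF h] by blast
    then have "L2_inner ?r ?h = 0" by (simp only: G0) (simp add: C2_inner_eq)
    moreover have "L2_inner ?l ?h = 0"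
      by (simp only: L2_inner_affine[OF h] G0) (simp add: C2_inner_eq)
    ultimately have "L2_inner ?h ?h = 0" by (simp only: L2_inner_diff_left[OF r L2_affine h]) simp
    then have "AE x in leb01. ?h x = 0"
      by (intro L2_orthogonal_imp_zero h) (simp only: L2_inner_def)
    then have ae: "AE x in leb01. f x = a + b * of_real (1 - x) - ?p x"
      by eventually_elim (simp add: algebra_simps)
    then have rl: "AE x in leb01. ?r x = ?l x" by eventually_elim simp
    have "K *v Gamma1 f + vector [a - mu0 w, b] \<in> C2_perp Y"
      unfolding C2_perp_def
    proof safe
      fix y assume y: "y \<in> Y"
      \<comment> \<open>Every y in Y is realised by an affine test function, which turns the
        identity on V_Y into orthogonality to all of Y.\<close>
      obtain c d where cd: "Gamma1 (\<lambda>x. c + d * of_real (1 - x)) = y" by (rule Gamma1_affine_surj)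
      let ?k = "\<lambda>x. c + d * of_real (1 - x)"
      have k: "?k \<in> L2" by (rule L2_affine)
      then have "?k \<in> V_Y Y" using y cd by (simp add: V_Y_def)
      then have "L2_inner ?r ?k + C2_inner (K *v Gamma1 f + vector [- mu0 w, 0]) (Gamma1 ?k) = 0"
        using L form[OF k] by blast
      also have "L2_inner ?r ?k = C2_inner (vector [a, b]) (Gamma1 ?k)"
        using L2_inner_cong_AE[OF r L2_affine rl k] L2_inner_affine[OF k] by simp
      finally show "C2_inner (K *v Gamma1 f + vector [a - mu0 w, b]) y = 0"
        unfolding cd by (simp add: C2_inner_eq algebra_simps)
    qed
    with ae show ?R by blast
  next
    assume ?R
    then obtain a b where ae: "AE x in leb01. f x = a + b * of_real (1 - x) - ?p x"
      and K: "K *v Gamma1 f + vector [a - mu0 w, b] \<in> C2_perp Y" by blast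
    let ?l = "\<lambda>x. a + b * of_real (1 - x)"
    have rl: "AE x in leb01. ?r x = ?l x" using ae by eventually_elim simp
    show ?L
    proof
      fix h assume "h \<in> V_Y Y"
      then have h: "h \<in> L2" and hY: "Gamma1 h \<in> Y" by (auto simp: V_Y_def)
      have "L2_inner ?r h = C2_inner (vector [a, b]) (Gamma1 h)"
        using L2_inner_cong_AE[OF r L2_affine rl h] L2_inner_affine[OF h] by simp
      moreover have "C2_inner (K *v Gamma1 f + vector [a - mu0 w, b]) (Gamma1 h) = 0"
        using K hY by (simp add: C2_perp_def)
      ultimately show "a_form K f h = Hm1T_inner w (emb h)"
        unfolding form[OF h] by (simp add: C2_inner_eq algebra_simps)
    qed
  qed
qed

text \<open>As Pw has mean zero, its primitive vanishes at 0 and at 1, so the affine part has the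
  boundary values of f: a = f(1) and b = f(0) - f(1).\<close>

lemma form_eq_iff:
  assumes f: "f \<in> L2" and w: "w \<in> Hm1T" and Y: "0 \<in> Y"
  shows "(\<forall>h\<in>V_Y Y. a_form K f h = Hm1T_inner w (emb h)) \<longleftrightarrow>
    f \<in> H1 \<and> w = (\<lambda>v. - dirichlet f v - (- mu0 w) * delta1 v) \<and>
    K *v Gamma1 f + vector [- mu0 w + crep f 1, crep f 0 - crep f 1] \<in> C2_perp Y" (is "?L \<longleftrightarrow> ?R")
proof -
  note p = P_op_L2[OF w] and i = L2_integrable[OF P_op_L2[OF w]]
  show ?thesis
  proof
    assume ?L
    then obtain a b where ae: "AE x in leb01. f x = a + b * of_real (1 - x) - prim (P_op w) x"
      and K: "K *v Gamma1 f + vector [a - mu0 w, b] \<in> C2_perp Y"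
      unfolding form_eq_iff_affine[OF f w Y] by blast
    \<comment> \<open>The derivative of the affine representation: b(1 - x) contributes -b, the
      primitive of Pw contributes -Pw.\<close>
    let ?g = "\<lambda>x. (- b) + - 1 * P_op w x"
    have g: "?g \<in> L2" by (intro L2_add L2_const L2_cmult p)
    have "AE x in leb01. f x = (a + b) + prim ?g x"
      using ae AE_space
    proof eventually_elim
      case (elim x)
      have pg: "prim ?g x = of_real x * (- b) + - 1 * prim (P_op w) x"
        using elim(2) by (subst prim_add) (auto simp: i prim_const prim_cmult[of "-1", simplified])
      show ?case unfolding elim(1) pg by (simp add: algebra_simps)
    qed
    note * = f g this
    have f1: "f \<in> H1" by (rule H1I[OF *])
    have g0: "(LINT x|leb01. ?g x) = - b" using i by (simp add: integral_P_op[OF w])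
    have c: "crep f 0 = a + b" "crep f 1 = a"
      using crep_0_eq[OF *] crep_1_eq[OF *] g0 by simp_all
    have m: "(LINT y|leb01. weak_deriv f y) = - b"
      using crep_1[OF f1] c by (simp add: eq_neg_iff_add_eq_0 add.commute)
    have "AE x in leb01. P_op w x = (LINT y|leb01. weak_deriv f y) - weak_deriv f x"
      using weak_deriv_eq[OF *] by eventually_elim (simp add: m)
    then show ?R using f1 K P_op_eq_iff[OF f1 w] by (simp add: c)
  next
    assume ?R
    then have f1: "f \<in> H1" and eq: "w = (\<lambda>v. - dirichlet f v - (- mu0 w) * delta1 v)"
      and K: "K *v Gamma1 f + vector [- mu0 w + crep f 1, crep f 0 - crep f 1] \<in> C2_perp Y" by blast+
    let ?m = "LINT y|leb01. weak_deriv f y"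
    have P: "AE x in leb01. P_op w x = ?m - weak_deriv f x"
      using P_op_eq_iff[OF f1 w] eq by blast
    note wd = weak_deriv_L2[OF f1]
    have prim: "prim (P_op w) x = of_real x * ?m - prim (weak_deriv f) x" if "0 \<le> x" "x \<le> 1" for x
    proof -
      have "prim (P_op w) x = prim (\<lambda>x. ?m - weak_deriv f x) x"
        by (intro prim_cong_AE L2_measurable p L2_intros wd P)
      then show ?thesis using prim_diff[of "\<lambda>_. ?m" "weak_deriv f" x] L2_integrable[OF wd]
        by (simp add: prim_const that)
    qed
    have "AE x in leb01. f x = crep f 1 + (crep f 0 - crep f 1) * of_real (1 - x) - prim (P_op w) x"
      using H1_rep[OF f1] AE_space
    proof eventually_elim
      case (elim x)
      then show ?case using crep_1[OF f1] by (simp add: prim algebra_simps)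
    qed
    moreover have "K *v Gamma1 f + vector [crep f 1 - mu0 w, crep f 0 - crep f 1] \<in> C2_perp Y"
      using K by simp
    ultimately show ?L unfolding form_eq_iff_affine[OF f w Y] by blast
  qed
qed

theorem theorem3p1:
  fixes Y :: "(complex^2) set" and K :: "complex^2^2"
  assumes "vec.subspace Y"
  shows
    "(Y \<noteq> {0} \<and> Y \<noteq> zero_times_C \<longrightarrow>
        A_dom Y K = {f \<in> H1. Gamma1 f \<in> Y \<and>
          (\<exists>!c. K *v Gamma1 f + vector [c + crep f 1, crep f 0 - crep f 1] \<in> C2_perp Y)} \<and>
        (\<forall>f\<in>A_dom Y K. \<forall>c.
          K *v Gamma1 f + vector [c + crep f 1, crep f 0 - crep f 1] \<in> C2_perp Y \<longrightarrow>
          A_op Y K f = (\<lambda>v. - Id_m_inv (second_deriv f) v - c * delta1 v))) \<and>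
     (Y = {0} \<or> Y = zero_times_C \<longrightarrow>
        A_dom Y K = {f \<in> H1. Gamma1 f \<in> Y \<and>
          K *v Gamma1 f + vector [crep f 1, crep f 0 - crep f 1] \<in> C2_perp Y} \<and>
        (\<forall>f\<in>A_dom Y K. A_op Y K f = (\<lambda>v. - Id_m_inv (second_deriv f) v)))"
proof -
  have Y0: "0 \<in> Y" using assms by (rule vec.subspace_0)
  define B where "B f c \<longleftrightarrow> K *v Gamma1 f + vector [c + crep f 1, crep f 0 - crep f 1] \<in> C2_perp Y" for f c
  define sol where "sol f w \<longleftrightarrow> w \<in> H_Y Y \<and> (\<forall>h\<in>V_Y Y. a_form K f h = Hm1T_inner w (emb h))" for f w
  \<comment> \<open>c stays a free parameter here; for a solution w it turns out to be
    \<open>- mu0 w\<close>.\<close>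
  define cand where "cand f c = (\<lambda>v. - Id_m_inv (second_deriv f) v - c * delta1 v)" for f and c :: complex
  have H_Y_sub: "w \<in> Hm1T" if "w \<in> H_Y Y" for w
    using that by (auto simp: H_Y_def Hzero_def split: if_splits)
  have L2_if_dom: "f \<in> L2 \<and> Gamma1 f \<in> Y" if "f \<in> V_Y Y" for f
    using that by (simp add: V_Y_def)
  have cand_eq: "cand f c = (\<lambda>v. - dirichlet f v - c * delta1 v)" if "f \<in> H1" for f c
    by (simp add: cand_def Id_m_inv_second_deriv[OF that])
  have sol_iff: "sol f w \<longleftrightarrow> f \<in> H1 \<and> (\<exists>c. w = cand f c \<and> cand f c \<in> H_Y Y \<and> B f c)"
    if f: "f \<in> L2" for f w
  proof
    assume "sol f w"
    then have w: "w \<in> H_Y Y" and form: "\<forall>h\<in>V_Y Y. a_form K f h = Hm1T_inner w (emb h)"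
      by (auto simp: sol_def)
    have "f \<in> H1" "w = (\<lambda>v. - dirichlet f v - (- mu0 w) * delta1 v)" "B f (- mu0 w)"
      using form_eq_iff[OF f H_Y_sub[OF w] Y0, THEN iffD1, OF form] unfolding B_def by blast+
    then show "f \<in> H1 \<and> (\<exists>c. w = cand f c \<and> cand f c \<in> H_Y Y \<and> B f c)"
      using w cand_eq[of f "- mu0 w"] by metis
  next
    assume "f \<in> H1 \<and> (\<exists>c. w = cand f c \<and> cand f c \<in> H_Y Y \<and> B f c)"
    then obtain c where f1: "f \<in> H1" and w: "w = cand f c" "w \<in> H_Y Y" and B: "B f c" by auto
    have c: "- mu0 w = c" using candidate_Hm1T(2)[OF f1, of c] by (simp add: w(1) cand_eq[OF f1])
    have "\<forall>h\<in>V_Y Y. a_form K f h = Hm1T_inner w (emb h)"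
      unfolding form_eq_iff[OF f H_Y_sub[OF w(2)] Y0] c
      using f1 B w(1) unfolding B_def cand_eq[OF f1] by blast
    then show "sol f w" using w(2) by (simp add: sol_def)
  qed
  have dom_iff: "f \<in> A_dom Y K \<longleftrightarrow> f \<in> H1 \<and> Gamma1 f \<in> Y \<and> (\<exists>c. cand f c \<in> H_Y Y \<and> B f c)" for f
  proof -
    have "f \<in> A_dom Y K \<longleftrightarrow> f \<in> V_Y Y \<and> (\<exists>w. sol f w)" by (auto simp: A_dom_def sol_def)
    then show ?thesis using sol_iff[of f] H1_L2[of f] by (auto simp: V_Y_def)
  qed
  \<comment> \<open>Every solution is some \<open>cand f c\<close>, so uniqueness of c gives the
    uniqueness required by the definite description in \<open>A_op\<close>.\<close>
  have op_eq: "A_op Y K f = cand f c"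
    if f: "f \<in> A_dom Y K" and c: "cand f c \<in> H_Y Y" "B f c"
      and unique: "\<And>c'. cand f c' \<in> H_Y Y \<Longrightarrow> B f c' \<Longrightarrow> c' = c" for f c
  proof -
    have f1: "f \<in> H1" using f dom_iff by blast
    show ?thesis
      unfolding A_op_def sol_def[symmetric] sol_iff[OF H1_L2[OF f1]]
      by (rule the_equality) (use f1 c unique in blast)+
  qed
  have cand_Hm1T: "cand f c \<in> Hm1T" and mu0_cand: "mu0 (cand f c) = - c" if "f \<in> H1" for f c
    using candidate_Hm1T[OF that, of c] by (simp_all add: cand_eq[OF that])
  show ?thesis
  proof (intro conjI impI)
    assume Y: "Y \<noteq> {0} \<and> Y \<noteq> zero_times_C"
    then have HY: "H_Y Y = Hm1T" by (simp add: H_Y_def)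
    \<comment> \<open>A nonzero subspace inside {0} x C is all of {0} x C, and both excluded cases
      are then ruled out.\<close>
    obtain y where y: "y \<in> Y" "y $ 1 \<noteq> 0"
    proof (rule ccontr)
      assume "\<not> thesis"
      with that have sub: "Y \<subseteq> zero_times_C" by (auto simp: zero_times_C_def)
      moreover have "zero_times_C \<subseteq> Y"
      proof
        fix z assume z: "z \<in> zero_times_C"
        from Y Y0 obtain u where u: "u \<in> Y" "u \<noteq> 0" by blast
        with sub have "u $ 1 = 0" by (auto simp: zero_times_C_def)
        with u have "u $ 2 \<noteq> 0" by (auto simp: vec_eq_iff forall_2)
        then have "z = (z $ 2 / u $ 2) *s u"
          using z \<open>u $ 1 = 0\<close> by (simp add: vec_eq_iff forall_2 zero_times_C_def)
        then show "z \<in> Y" using vec.subspace_scale[OF assms u(1)] by metis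
      qed
      ultimately show False using Y by blast
    qed
    \<comment> \<open>Pairing the boundary condition with y, a change of c shows up multiplied by
      the conjugate of \<open>y $ 1\<close>, which is nonzero.\<close>
    have unique: "c' = c" if "B f c" "B f c'" for f c c'
    proof -
      have "C2_inner (K *v Gamma1 f + vector [c + crep f 1, crep f 0 - crep f 1]) y = 0"
        "C2_inner (K *v Gamma1 f + vector [c' + crep f 1, crep f 0 - crep f 1]) y = 0"
        using that y by (auto simp: B_def C2_perp_def)
      moreover have "(c' - c) * cnj (y $ 1) =
          C2_inner (K *v Gamma1 f + vector [c' + crep f 1, crep f 0 - crep f 1]) y -
          C2_inner (K *v Gamma1 f + vector [c + crep f 1, crep f 0 - crep f 1]) y"
        by (simp add: C2_inner_eq algebra_simps)
      ultimately have "(c' - c) * cnj (y $ 1) = 0" by simp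
      then show ?thesis using y by simp
    qed
    show "A_dom Y K = {f \<in> H1. Gamma1 f \<in> Y \<and>
          (\<exists>!c. K *v Gamma1 f + vector [c + crep f 1, crep f 0 - crep f 1] \<in> C2_perp Y)}"
      unfolding B_def[symmetric] using dom_iff cand_Hm1T unique unfolding HY by blast
    show "\<forall>f\<in>A_dom Y K. \<forall>c.
          K *v Gamma1 f + vector [c + crep f 1, crep f 0 - crep f 1] \<in> C2_perp Y \<longrightarrow>
          A_op Y K f = (\<lambda>v. - Id_m_inv (second_deriv f) v - c * delta1 v)"
      unfolding B_def[symmetric] cand_def[symmetric]
      using op_eq dom_iff cand_Hm1T unique unfolding HY by blast
  next
    assume Y: "Y = {0} \<or> Y = zero_times_C"
    then have HY: "H_Y Y = Hzero" by (simp add: H_Y_def)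
    \<comment> \<open>\<open>mu0 (cand f c)\<close> is -c, so the mean-zero space admits c = 0
      alone.\<close>
    have cand_iff: "cand f c \<in> H_Y Y \<longleftrightarrow> c = 0" if "f \<in> H1" for f c
      unfolding HY Hzero_def using cand_Hm1T[OF that] mu0_cand[OF that] by simp
    have B0: "B f 0 \<longleftrightarrow> K *v Gamma1 f + vector [crep f 1, crep f 0 - crep f 1] \<in> C2_perp Y" for f
      by (simp add: B_def)
    have cand0: "cand f 0 = (\<lambda>v. - Id_m_inv (second_deriv f) v)" for f
      by (simp add: cand_def)
    show "A_dom Y K = {f \<in> H1. Gamma1 f \<in> Y \<and>
          K *v Gamma1 f + vector [crep f 1, crep f 0 - crep f 1] \<in> C2_perp Y}"
      unfolding B0[symmetric]
    proof (rule set_eqI)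
      fix f
      have "(\<exists>c. cand f c \<in> H_Y Y \<and> B f c) \<longleftrightarrow> B f 0" if "f \<in> H1"
        by (simp add: cand_iff[OF that])
      then show "f \<in> A_dom Y K \<longleftrightarrow> f \<in> {f \<in> H1. Gamma1 f \<in> Y \<and> B f 0}"
        unfolding dom_iff by auto
    qed
    show "\<forall>f\<in>A_dom Y K. A_op Y K f = (\<lambda>v. - Id_m_inv (second_deriv f) v)"
      unfolding cand0[symmetric]
    proof
      fix f assume f: "f \<in> A_dom Y K"
      then obtain c where f1: "f \<in> H1" and c: "cand f c \<in> H_Y Y" "B f c" using dom_iff by blast
      then have "c = 0" using cand_iff by blast
      then show "A_op Y K f = cand f 0"
        using c by (intro op_eq[OF f]) (auto simp: cand_iff[OF f1])
    qed
  qed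
qed

end
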